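(* Let $x'\in(-1,1)$ and $\mu\in\mathbb C$ with $2\mu+1\notin\{0,-1,-2,\ldots\}$. Then, in the sense of distributions in $x\in(-1,1)$, $$\sum_{n=0}^\infty\frac{(\mu+n+\frac12)\,\Gamma(2\mu+n+1)}{n!}\,{\sf P}_{n+\mu}^{-\mu}(x)\,{\sf P}_{n+\mu}^{-\mu}(x')=\delta(x-x').$$
   Context: The identity is a closure relation: both sides are treated as distributions, i.e. it means that for every test function $f\in C_c^\infty((-1,1))$, $$\sum_{n=0}^\infty\frac{(\mu+n+\frac12)\,\Gamma(2\mu+n+1)}{n!}\,{\sf P}_{n+\mu}^{-\mu}(x')\int_{-1}^1f(x)\,{\sf P}_{n+\mu}^{-\mu}(x)\,\mathrm dx=f(x').$$ $\delta$ is the Dirac delta distribution. The Ferrers function of the first kind is, for $\nu,\mu\in\mathbb C$ and $x\in(-1,1)$, $${\sf P}_\nu^{-\mu}(x)=\frac{1}{\Gamma(\mu+1)}\left(\frac{1-x}{1+x}\right)^{\frac{\mu}{2}}{}_2F_1\left(-\nu,\nu+1;\mu+1;\frac{1-x}{2}\right)=\left(\frac{1-x}{1+x}\right)^{\frac{\mu}{2}}\sum_{j=0}^\infty\frac{(-\nu)_j(\nu+1)_j}{\Gamma(\mu+1+j)\,j!}\left(\frac{1-x}{2}\right)^j,$$ where $(a)_0=1$, $(a)_j=a(a+1)\cdots(a+j-1)$ and $1/\Gamma$ is the entire reciprocal gamma function. *)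

theory Defs
  imports "HOL-Analysis.Analysis"
begin

text \<open>
  Ferrers function of the first kind of degree \<open>\<nu>\<close> and order \<open>m\<close>, for \<open>-1 < x < 1\<close>. The factor
  \<open>1 / \<Gamma>(1 - m)\<close> is absorbed into the hypergeometric series via the entire function \<^const>\<open>rGamma\<close>,
  so that every complex order is covered. The power has a positive real base, hence is the
  principal one.
\<close>
definition Ferrers_P :: "complex \<Rightarrow> complex \<Rightarrow> real \<Rightarrow> complex" where
  "Ferrers_P \<nu> m x =
     complex_of_real ((1 - x) / (1 + x)) powr (- m / 2) *
     (\<Sum>j. pochhammer (- \<nu>) j * pochhammer (\<nu> + 1) j * rGamma (- m + 1 + of_nat j) / fact j *
          complex_of_real ((1 - x) / 2) ^ j)"

lemma Ferrers_P_uminus_order: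
  "Ferrers_P \<nu> (- \<mu>) x =
     complex_of_real ((1 - x) / (1 + x)) powr (\<mu> / 2) *
     (\<Sum>j. pochhammer (- \<nu>) j * pochhammer (\<nu> + 1) j / (Gamma (\<mu> + 1 + of_nat j) * fact j) *
          complex_of_real ((1 - x) / 2) ^ j)"
  by (simp add: Ferrers_P_def rGamma_inverse_Gamma divide_simps)

definition smooth :: "(real \<Rightarrow> complex) \<Rightarrow> bool" where
  "smooth f \<longleftrightarrow>
     (\<forall>k x. ((\<lambda>g t. vector_derivative g (at t)) ^^ k) f differentiable (at x))"

text \<open>
  \<open>C\<^sub>c\<^sup>\<infinity>(U)\<close> for open \<open>U\<close>; its members are represented by their extension by zero to the real line.
\<close>
definition test_functions :: "real set \<Rightarrow> (real \<Rightarrow> complex) set" where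
  "test_functions U =
     {f. smooth f \<and> compact (closure {x. f x \<noteq> 0}) \<and> closure {x. f x \<noteq> 0} \<subseteq> U}"

end

theory Submission
  imports Defs "HOL-Complex_Analysis.Complex_Analysis"
begin

text \<open>
  Let \<open>p\<^sub>n(x) = \<^sub>2F\<^sub>1(-n, n + 2\<mu> + 1; \<mu> + 1; (1 - x)/2)\<close>, a multiple of the Gegenbauer polynomial with
  parameter \<open>\<mu> + 1/2\<close>. Euler's transformation (\<open>Ferrers_P_eq_gegen\<close>) shows that the Ferrers
  function of degree \<open>n + \<mu>\<close> and order \<open>-\<mu>\<close> is \<open>(1 - x\<^sup>2)\<^sup>\<mu>\<^sup>/\<^sup>2 p\<^sub>n(x)\<close> up to a factor independent of \<open>n\<close>
  and \<open>x\<close>. After division of the test function by \<open>(1 - x\<^sup>2)\<^sup>\<mu>\<^sup>/\<^sup>2\<close>, the claim is that a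
  smooth function \<open>h\<close> with compact support in \<open>(-1, 1)\<close> is the sum of its Gegenbauer expansion
  \<open>\<Sum> k\<^sub>n p\<^sub>n(x) c\<^sub>n(h)\<close> with \<open>c\<^sub>n(h) = \<integral> h p\<^sub>n (1 - x\<^sup>2)\<^sup>\<mu> dx\<close> (\<open>gegen_expansion\<close>). For complex \<open>\<mu>\<close>, and in
  particular for \<open>Re \<mu> \<le> -1\<close>, where the weight is not integrable, Hilbert space methods are not
  available; the argument is elementary instead and has four ingredients.

  \<^item> Rapid decay (\<open>gegen_pairing_decay\<close>): \<open>p\<^sub>n\<close> is an eigenfunction of the Gegenbauer operator, which is
    symmetric with respect to the weight, with an eigenvalue of order \<open>n\<^sup>2\<close>. Since \<open>p\<^sub>n\<close> is polynomially bounded on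
    \<open>[-1, 1]\<close> (\<open>gegen_growth\<close>), \<open>c\<^sub>n(h)\<close> decays faster than any power of \<open>n\<close>.

  \<^item> Localisation (\<open>sums_gegen_term_at_zero\<close>): if \<open>h(y) = 0\<close>, then \<open>h(x) = (x - y) g(x)\<close> with \<open>g\<close>
    smooth, and the Christoffel-Darboux formula collapses the \<open>N\<close>-th partial sum at \<open>y\<close> to two terms
    with the coefficients \<open>c\<^sub>N(g)\<close> and \<open>c\<^sub>N\<^sub>+\<^sub>1(g)\<close>. So the expansion at \<open>y\<close> sums to zero.

  \<^item> Normalisation (\<open>gegen_expansion_base\<close>): for \<open>Re \<mu> > 1\<close> the first two ingredients need no compact
    support, so that it suffices to expand the constant \<open>h(x)\<close>. Its only non-zero coefficient is
    \<open>c\<^sub>0\<close>, a Beta integral.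

  \<^item> Descent (\<open>gegen_expansion_shift\<close>): the termwise derivative of the expansion of \<open>h\<close> for \<open>\<mu>\<close> is the
    expansion of \<open>h'\<close> for \<open>\<mu> + 1\<close>. Hence the result for \<open>\<mu> + 1\<close> gives the one for \<open>\<mu>\<close> up to an additive
    constant, which is zero by localisation at a zero of \<open>h\<close>.
\<close>

(* The dollar sign denotes the coefficients of a formal power series only. *)
unbundle no vec_syntax

section \<open>Gegenbauer polynomials as hypergeometric polynomials\<close>

text \<open>
  Coefficients of the hypergeometric polynomial \<open>\<^sub>2F\<^sub>1(-n, n + 2\<mu> + 1; \<mu> + 1; z)\<close>.
\<close>
definition gegen_coeff :: "complex \<Rightarrow> nat \<Rightarrow> nat \<Rightarrow> complex" where
  "gegen_coeff \<mu> n j =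
     pochhammer (- of_nat n) j * pochhammer (of_nat n + 2 * \<mu> + 1) j / (pochhammer (\<mu> + 1) j * fact j)"

text \<open>
  The hypergeometric polynomial itself, as a polynomial in \<open>z = (1 - x) / 2\<close>.
\<close>
definition gegen_poly :: "complex \<Rightarrow> nat \<Rightarrow> complex poly" where
  "gegen_poly \<mu> n = (\<Sum>j\<le>n. monom (gegen_coeff \<mu> n j) j)"

text \<open>
  \<open>p\<^sub>n(x)\<close>: the Gegenbauer polynomial with parameter \<open>\<mu> + 1/2\<close>, normalised by \<open>p\<^sub>n(1) = 1\<close>.
\<close>
definition gegen :: "complex \<Rightarrow> nat \<Rightarrow> real \<Rightarrow> complex" where
  "gegen \<mu> n x = poly (gegen_poly \<mu> n) (of_real ((1 - x) / 2))"

lemma gegen_coeff_0 [simp]: "gegen_coeff \<mu> n 0 = 1"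
  by (simp add: gegen_coeff_def)

lemma coeff_gegen_poly: "coeff (gegen_poly \<mu> n) j = gegen_coeff \<mu> n j"
proof -
  have "gegen_coeff \<mu> n j = 0" if "j > n"
    using that by (simp add: gegen_coeff_def pochhammer_of_nat_eq_0_lemma)
  thus ?thesis
    by (auto simp: gegen_poly_def coeff_sum if_distrib cong: if_cong)
qed

lemma gegen_0 [simp]: "gegen \<mu> 0 x = 1"
  by (simp add: gegen_def gegen_poly_def)

text \<open>
  The exclusions on \<open>\<mu>\<close> hidden in \<open>2\<mu> + 1 \<notin> {0, -1, -2, \<dots>}\<close>. The last fact says that the hypothesis
  survives the step from \<open>\<mu>\<close> to \<open>\<mu> + 1\<close>.
\<close>
lemma gegen_order_regular:
  fixes \<mu> :: complex
  assumes "2 * \<mu> + 1 \<notin> \<int>\<^sub>\<le>\<^sub>0"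
  shows "\<mu> + 1 + of_nat j \<noteq> 0" "2 * \<mu> + 1 + of_nat j \<noteq> 0" "\<mu> + 1 \<notin> \<int>\<^sub>\<le>\<^sub>0"
    "\<mu> + 1 \<noteq> 0" "2 * (\<mu> + 1) + 1 \<notin> \<int>\<^sub>\<le>\<^sub>0"
proof -
  have *: "2 * \<mu> + 1 + of_nat k \<noteq> 0" for k
    using assms by (metis add_eq_0_iff minus_of_nat_in_nonpos_Ints add.commute minus_minus)
  show 1: "\<mu> + 1 + of_nat j \<noteq> 0" for j
  proof
    assume "\<mu> + 1 + of_nat j = 0"
    hence "2 * (\<mu> + 1 + of_nat j) = 0" by simp
    hence "2 * \<mu> + 1 + of_nat (2 * j + 1) = 0" by (simp add: algebra_simps)
    thus False using * by blast
  qed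
  show "2 * \<mu> + 1 + of_nat j \<noteq> 0" by (rule *)
  show "\<mu> + 1 \<noteq> 0" using 1[of 0] by simp
  show "\<mu> + 1 \<notin> \<int>\<^sub>\<le>\<^sub>0" using 1 by (metis add.left_inverse nonpos_Ints_cases')
  show "2 * (\<mu> + 1) + 1 \<notin> \<int>\<^sub>\<le>\<^sub>0"
  proof
    assume "2 * (\<mu> + 1) + 1 \<in> \<int>\<^sub>\<le>\<^sub>0"
    then obtain k where "2 * (\<mu> + 1) + 1 = - of_nat k" by (auto elim!: nonpos_Ints_cases')
    hence "2 * \<mu> + 1 + of_nat (k + 2) = 0" by (simp add: algebra_simps)
    thus False using * by blast
  qed
qed

lemma gegen_coeff_Suc:
  assumes "2 * \<mu> + 1 \<notin> \<int>\<^sub>\<le>\<^sub>0"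
  shows "of_nat (Suc j) * (\<mu> + 1 + of_nat j) * gegen_coeff \<mu> n (Suc j) =
         (of_nat j - of_nat n) * (of_nat n + 2 * \<mu> + 1 + of_nat j) * gegen_coeff \<mu> n j"
proof -
  have nz: "(\<mu> + 1 + of_nat j) \<noteq> 0" "of_nat (Suc j) \<noteq> (0::complex)"
    using gegen_order_regular[OF assms] by (auto simp del: of_nat_Suc)
  have "gegen_coeff \<mu> n (Suc j) = gegen_coeff \<mu> n j *
      ((- of_nat n + of_nat j) * (of_nat n + 2 * \<mu> + 1 + of_nat j)) / ((\<mu> + 1 + of_nat j) * of_nat (Suc j))"
    unfolding gegen_coeff_def pochhammer_Suc fact_Suc by (simp del: of_nat_Suc add: mult_ac)
  thus ?thesis using nz by (simp del: of_nat_Suc)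
qed

lemma gegen_coeff_shift:
  assumes "2 * \<mu> + 1 \<notin> \<int>\<^sub>\<le>\<^sub>0"
  shows "of_nat (Suc j) * gegen_coeff \<mu> (Suc n) (Suc j) =
         - of_nat (Suc n) * (of_nat (Suc n) + 2 * \<mu> + 1) / (\<mu> + 1) * gegen_coeff (\<mu> + 1) n j"
proof -
  have nz: "of_nat (Suc j) \<noteq> (0::complex)" by (simp del: of_nat_Suc)
  have e: "- of_nat (Suc n) + 1 = (- of_nat n :: complex)"
    "of_nat (Suc n) + 2 * \<mu> + 1 + 1 = of_nat n + 2 * (\<mu> + 1) + 1" by simp_all
  have "gegen_coeff \<mu> (Suc n) (Suc j) = - of_nat (Suc n) * (of_nat (Suc n) + 2 * \<mu> + 1) /
      ((\<mu> + 1) * of_nat (Suc j)) * gegen_coeff (\<mu> + 1) n j"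
    unfolding gegen_coeff_def pochhammer_rec[of _ j] fact_Suc e 
    by (simp del: of_nat_Suc add: mult_ac) 
  thus ?thesis using nz by (simp del: of_nat_Suc)
qed

lemma pderiv_gegen_poly:
  assumes "2 * \<mu> + 1 \<notin> \<int>\<^sub>\<le>\<^sub>0"
  shows "pderiv (gegen_poly \<mu> n) =
    smult (- of_nat n * (of_nat n + 2 * \<mu> + 1) / (\<mu> + 1)) (gegen_poly (\<mu> + 1) (n - 1))"
proof (cases n)
  case 0
  thus ?thesis by (simp add: gegen_poly_def pderiv_monom)
next
  case (Suc m)
  show ?thesis
    by (rule poly_eqI) (use gegen_coeff_shift[OF assms, of _ m] Suc in \<open>simp add: coeff_pderiv coeff_gegen_poly\<close>)
qed

lemma gegen_poly_ode:
  assumes "2 * \<mu> + 1 \<notin> \<int>\<^sub>\<le>\<^sub>0"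
  shows "[:0, 1, -1:] * pderiv (pderiv (gegen_poly \<mu> n)) + smult (\<mu> + 1) ([:1, -2:] * pderiv (gegen_poly \<mu> n))
     + smult (of_nat n * (of_nat n + 2 * \<mu> + 1)) (gegen_poly \<mu> n) = 0" (is "?P = 0")
proof (rule poly_eqI)
  fix j
  define a b where "a = gegen_coeff \<mu> n j" and "b = gegen_coeff \<mu> n (Suc j)"
  define J N :: complex where "J = of_nat j" and "N = of_nat n"
  have 1: "coeff ([:0, 1, -1:] * pderiv (pderiv (gegen_poly \<mu> n))) j = J * (J + 1) * b - J * (J - 1) * a"
  proof (cases j)
    case (Suc i)
    thus ?thesis
      by (cases i) (simp_all add: coeff_pderiv coeff_gegen_poly a_def b_def J_def algebra_simps)
  qed (simp add: J_def)
  have 2: "coeff ([:1, -2:] * pderiv (gegen_poly \<mu> n)) j = (J + 1) * b - 2 * J * a"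
    by (cases j) (simp_all add: coeff_pderiv coeff_gegen_poly a_def b_def J_def algebra_simps)
  have 3: "(J + 1) * (\<mu> + 1 + J) * b = (J - N) * (N + 2 * \<mu> + 1 + J) * a"
    using gegen_coeff_Suc[OF assms, of j n] by (simp add: a_def b_def J_def N_def add_ac)
  have "coeff ?P j = J * (J + 1) * b - J * (J - 1) * a + (\<mu> + 1) * ((J + 1) * b - 2 * J * a)
      + N * (N + 2 * \<mu> + 1) * a"
    unfolding coeff_add coeff_smult 1 2 by (simp add: coeff_gegen_poly a_def N_def)
  also have "\<dots> = 0"
    using 3 by algebra
  finally show "coeff ?P j = coeff 0 j" by simp
qed

text \<open>
  The three-term recurrence, coefficient by coefficient. With the common factor
  \<open>X = (-m)\<^sub>j (m + c)\<^sub>j\<close>, where \<open>m = n + 1\<close> and \<open>c = 2\<mu> + 1\<close>, all four coefficients become polynomial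
  multiples of \<open>X\<close>, and a polynomial identity remains.
\<close>
lemma gegen_coeff_rec:
  assumes "2 * \<mu> + 1 \<notin> \<int>\<^sub>\<le>\<^sub>0"
  shows "(of_nat (Suc n) + 2 * \<mu> + 1) * gegen_coeff \<mu> (Suc (Suc n)) (Suc j) + of_nat (Suc n) * gegen_coeff \<mu> n (Suc j)
    = (2 * of_nat (Suc n) + 2 * \<mu> + 1) * (gegen_coeff \<mu> (Suc n) (Suc j) - 2 * gegen_coeff \<mu> (Suc n) j)"
proof -
  define m :: complex where "m = of_nat (Suc n)"
  define c where "c = 2 * \<mu> + 1"
  define X where "X = pochhammer (- m) j * pochhammer (m + c) j"
  define D where "D = pochhammer (\<mu> + 1) j * fact j"
  define J :: complex where "J = of_nat j"
  have nz: "D \<noteq> 0" "\<mu> + 1 + J \<noteq> 0" "J + 1 \<noteq> 0"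
    using gegen_order_regular(1,3)[OF assms] of_nat_neq_0[where 'a = complex, of j]
    by (auto simp: D_def J_def pochhammer_eq_0_iff add_ac)
  define E where "E = D * (\<mu> + 1 + J) * (J + 1)"
  have E: "pochhammer (\<mu> + 1) (Suc j) * fact (Suc j) = E"
    by (simp add: pochhammer_Suc E_def D_def J_def algebra_simps)
  have En: "E \<noteq> 0" using nz by (simp add: E_def)
  have P1: "pochhammer (- m - 1) (Suc j) = (- m - 1) * pochhammer (- m) j"
    by (simp add: pochhammer_rec)
  have P2: "(m + c) * pochhammer (m + 1 + c) (Suc j) = pochhammer (m + c) j * (m + c + J) * (m + c + J + 1)"
    using pochhammer_rec[of "m + c" "Suc j"] by (simp add: pochhammer_Suc J_def algebra_simps)
  have P3: "m * pochhammer (- m + 1) (Suc j) = pochhammer (- m) j * (m - J) * (- m + J + 1)"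
    using pochhammer_rec[of "-m" "Suc j"] by (simp add: pochhammer_Suc J_def algebra_simps)
  have P4: "pochhammer (m + c - 1) (Suc j) = (m + c - 1) * pochhammer (m + c) j"
    by (simp add: pochhammer_rec)
  have A1: "(m + c) * gegen_coeff \<mu> (Suc (Suc n)) (Suc j) = (- m - 1) * (m + c + J) * (m + c + J + 1) * X / E"
  proof -
    have "gegen_coeff \<mu> (Suc (Suc n)) (Suc j) = pochhammer (- m - 1) (Suc j) * pochhammer (m + 1 + c) (Suc j) / E"
      unfolding gegen_coeff_def E by (simp add: m_def c_def add_ac)
    hence "(m + c) * gegen_coeff \<mu> (Suc (Suc n)) (Suc j) =
       (pochhammer (- m - 1) (Suc j) * ((m + c) * pochhammer (m + 1 + c) (Suc j))) / E" by simp
    thus ?thesis unfolding P1 P2 X_def by (simp add: mult_ac)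
  qed
  have A2: "m * gegen_coeff \<mu> n (Suc j) = (m - J) * (- m + J + 1) * (m + c - 1) * X / E"
  proof -
    have "gegen_coeff \<mu> n (Suc j) = pochhammer (- m + 1) (Suc j) * pochhammer (m + c - 1) (Suc j) / E"
      unfolding gegen_coeff_def E by (simp add: m_def c_def add_ac)
    hence "m * gegen_coeff \<mu> n (Suc j) =
       ((m * pochhammer (- m + 1) (Suc j)) * pochhammer (m + c - 1) (Suc j)) / E" by simp
    thus ?thesis unfolding P3 P4 X_def by (simp add: mult_ac)
  qed
  have A3: "gegen_coeff \<mu> (Suc n) (Suc j) = (- m + J) * (m + c + J) * X / E"
    unfolding gegen_coeff_def E by (simp add: pochhammer_Suc X_def m_def c_def J_def add_ac mult_ac)
  have A4: "gegen_coeff \<mu> (Suc n) j = (\<mu> + 1 + J) * (J + 1) * X / E"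
  proof -
    have "gegen_coeff \<mu> (Suc n) j = X / D"
      by (simp add: gegen_coeff_def X_def D_def m_def c_def add_ac)
    thus ?thesis using nz by (simp add: E_def)
  qed
  have "(- m - 1) * (m + c + J) * (m + c + J + 1) + ((m - J) * (- m + J + 1) * (m + c - 1))
    = (2 * m + c) * ((- m + J) * (m + c + J) - 2 * ((\<mu> + 1 + J) * (J + 1)))"
    unfolding c_def by algebra
  hence "(m + c) * gegen_coeff \<mu> (Suc (Suc n)) (Suc j) + m * gegen_coeff \<mu> n (Suc j)
    = (2 * m + c) * (gegen_coeff \<mu> (Suc n) (Suc j) - 2 * gegen_coeff \<mu> (Suc n) j)"
    unfolding A1 A2 A3 A4 using En by (simp add: divide_simps) algebra
  thus ?thesis by (simp add: m_def c_def add_ac)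
qed

lemma gegen_poly_rec:
  assumes "2 * \<mu> + 1 \<notin> \<int>\<^sub>\<le>\<^sub>0"
  shows "smult (of_nat (Suc n) + 2 * \<mu> + 1) (gegen_poly \<mu> (Suc (Suc n))) + smult (of_nat (Suc n)) (gegen_poly \<mu> n)
    = smult (2 * of_nat (Suc n) + 2 * \<mu> + 1) ([:1, -2:] * gegen_poly \<mu> (Suc n))" (is "?P = ?Q")
proof (rule poly_eqI)
  fix j
  show "coeff ?P j = coeff ?Q j"
    using gegen_coeff_rec[OF assms, of n "j - 1"]
    by (cases j) (simp_all add: coeff_gegen_poly)
qed

lemma gegen_rec:
  assumes "2 * \<mu> + 1 \<notin> \<int>\<^sub>\<le>\<^sub>0"
  shows "(of_nat (Suc n) + 2 * \<mu> + 1) * gegen \<mu> (Suc (Suc n)) x + of_nat (Suc n) * gegen \<mu> n x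
    = (2 * of_nat (Suc n) + 2 * \<mu> + 1) * of_real x * gegen \<mu> (Suc n) x"
proof -
  define z where "z = complex_of_real ((1 - x) / 2)"
  have z: "of_real x = 1 - 2 * z" by (simp add: z_def field_simps)
  show ?thesis
    using arg_cong[OF gegen_poly_rec[OF assms, of n], of "\<lambda>p. poly p z"]
    unfolding gegen_def z_def[symmetric] z by (simp add: algebra_simps)
qed

lemma gegen_1:
  assumes "2 * \<mu> + 1 \<notin> \<int>\<^sub>\<le>\<^sub>0"
  shows "gegen \<mu> (Suc 0) x = of_real x"
proof -
  have "gegen_coeff \<mu> (Suc 0) (Suc 0) = - 2"
    using gegen_order_regular(4)[OF assms] by (simp add: gegen_coeff_def divide_simps)
  thus ?thesis by (simp add: gegen_def gegen_poly_def poly_monom diff_divide_distrib)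
qed

lemma has_vector_derivative_poly_half:
  "((\<lambda>x. poly q (complex_of_real ((1 - x) / 2))) has_vector_derivative
      - poly (pderiv q) (of_real ((1 - x) / 2)) / 2) (at x within A)"
proof -
  let ?z = "\<lambda>x. complex_of_real ((1 - x) / 2)"
  have "((\<lambda>x. ?z x) has_vector_derivative (- 1 / 2)) (at x within A)"
    by (rule derivative_eq_intros refl | simp)+
  from field_vector_diff_chain_within[OF this, of "poly q" "poly (pderiv q) (?z x)"]
  show ?thesis
    by (simp add: o_def poly_DERIV has_field_derivative_at_within)
qed

text \<open>
  The first two derivatives of \<^const>\<open>gegen\<close> in \<open>x\<close>, written through \<open>z = (1 - x) / 2\<close>.
\<close>
definition gegen_deriv :: "complex \<Rightarrow> nat \<Rightarrow> real \<Rightarrow> complex" where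
  "gegen_deriv \<mu> n x = - poly (pderiv (gegen_poly \<mu> n)) (of_real ((1 - x) / 2)) / 2"

definition gegen_deriv2 :: "complex \<Rightarrow> nat \<Rightarrow> real \<Rightarrow> complex" where
  "gegen_deriv2 \<mu> n x = poly (pderiv (pderiv (gegen_poly \<mu> n))) (of_real ((1 - x) / 2)) / 4"

lemma has_vector_derivative_gegen:
  "(gegen \<mu> n has_vector_derivative gegen_deriv \<mu> n x) (at x within A)"
  unfolding gegen_def[abs_def] gegen_deriv_def by (rule has_vector_derivative_poly_half)

lemma has_vector_derivative_gegen_deriv:
  "(gegen_deriv \<mu> n has_vector_derivative gegen_deriv2 \<mu> n x) (at x within A)"
proof -
  have "((\<lambda>x. (- 1 / 2) * poly (pderiv (gegen_poly \<mu> n)) (complex_of_real ((1 - x) / 2)))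
     has_vector_derivative (- 1 / 2) * (- poly (pderiv (pderiv (gegen_poly \<mu> n))) (of_real ((1 - x) / 2)) / 2)) (at x within A)"
    by (intro has_vector_derivative_mult_right has_vector_derivative_poly_half)
  thus ?thesis
    by (simp add: gegen_deriv_def[abs_def] gegen_deriv2_def)
qed

lemma gegen_deriv_eq:
  assumes "2 * \<mu> + 1 \<notin> \<int>\<^sub>\<le>\<^sub>0"
  shows "gegen_deriv \<mu> n x =
           of_nat n * (of_nat n + 2 * \<mu> + 1) / (2 * (\<mu> + 1)) * gegen (\<mu> + 1) (n - 1) x"
  unfolding gegen_deriv_def pderiv_gegen_poly[OF assms] gegen_def poly_smult
  by (simp del: distrib_left_numeral add: mult_ac)

lemma gegen_ode:
  assumes "2 * \<mu> + 1 \<notin> \<int>\<^sub>\<le>\<^sub>0"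
  shows "of_real (1 - x\<^sup>2) * gegen_deriv2 \<mu> n x - 2 * (\<mu> + 1) * of_real x * gegen_deriv \<mu> n x =
           - (of_nat n * (of_nat n + 2 * \<mu> + 1)) * gegen \<mu> n x"
proof -
  define z where "z = complex_of_real ((1 - x) / 2)"
  have z: "of_real x = 1 - 2 * z" by (simp add: z_def field_simps)
  have z2: "complex_of_real (1 - x\<^sup>2) = 4 * z * (1 - z)"
    by (simp add: z power2_eq_square algebra_simps)
  show ?thesis
    using arg_cong[OF gegen_poly_ode[OF assms, of n], of "\<lambda>p. poly p z"]
    unfolding gegen_def gegen_deriv_def gegen_deriv2_def z_def[symmetric] z2 z
    by (simp add: mult_ac) algebra
qed

section \<open>Euler's transformation of the Ferrers function\<close>

text \<open>
  The binomial series of \<open>(1 - z)\<^sup>a\<close>.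
\<close>
definition fps_one_minus_powr :: "complex \<Rightarrow> complex fps" where
  "fps_one_minus_powr a = Abs_fps (\<lambda>k. pochhammer (- a) k / fact k)"

lemma fps_deriv_one_minus_powr:
  "fps_deriv (fps_one_minus_powr a) = - fps_const a * fps_one_minus_powr (a - 1)"
proof (rule fps_ext)
  fix k
  have "of_nat (Suc k) * (pochhammer (- a) (Suc k) / fact (Suc k)) = - a * (pochhammer (- (a - 1)) k / fact k)"
    unfolding pochhammer_rec fact_Suc by (simp del: of_nat_Suc add: add.commute)
  thus "fps_deriv (fps_one_minus_powr a) $ k = (- fps_const a * fps_one_minus_powr (a - 1)) $ k"
    by (simp add: fps_one_minus_powr_def flip: fps_const_neg)
qed

lemma fps_one_minus_powr_rec:
  "fps_one_minus_powr a = (1 - fps_X) * fps_one_minus_powr (a - 1)"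
proof (rule fps_ext)
  fix k
  show "fps_one_minus_powr a $ k = ((1 - fps_X) * fps_one_minus_powr (a - 1)) $ k"
  proof (cases k)
    case 0
    thus ?thesis by (simp add: fps_one_minus_powr_def)
  next
    case (Suc m)
    define P F M where "P = pochhammer (1 - a) m" and "F = (fact m :: complex)" and "M = (of_nat (Suc m) :: complex)"
    have nz: "F \<noteq> 0" "M \<noteq> 0" by (simp_all add: F_def M_def del: of_nat_Suc)
    have "- a * P / (M * F) = P * (1 - a + (M - 1)) / (M * F) - P / F"
      using nz by (simp add: field_simps)
    moreover have "fps_one_minus_powr a $ k = - a * P / (M * F)"
      unfolding Suc fps_one_minus_powr_def fps_nth_Abs_fps pochhammer_rec fact_Suc P_def F_def M_def
      by (simp add: add.commute)
    moreover have "((1 - fps_X) * fps_one_minus_powr (a - 1)) $ k = P * (1 - a + (M - 1)) / (M * F) - P / F"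
      unfolding Suc by (simp add: left_diff_distrib fps_one_minus_powr_def pochhammer_Suc P_def F_def M_def)
    ultimately show ?thesis by simp
  qed
qed

lemma sums_one_minus_powr:
  assumes "norm z < 1"
  shows "(\<lambda>n. fps_one_minus_powr a $ n * z ^ n) sums ((1 - z) powr a)"
proof -
  have "(\<lambda>n. (a gchoose n) * (- z) ^ n) sums (1 + (- z)) powr a"
    using assms by (intro gen_binomial_complex) simp
  moreover have "(a gchoose n) * (- z) ^ n = fps_one_minus_powr a $ n * z ^ n" for n
  proof -
    have "(-1) ^ n * (-1) ^ n = (1 :: complex)" by (simp flip: power_mult_distrib)
    thus ?thesis
      by (simp add: gbinomial_pochhammer fps_one_minus_powr_def power_minus[of z] mult_ac)
  qed
  ultimately show ?thesis by simp
qed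

lemma fps_conv_radius_one_minus_powr: "fps_conv_radius (fps_one_minus_powr a) \<ge> 1"
  unfolding fps_conv_radius_def
proof (rule conv_radius_geI_ex)
  fix r :: real assume "r > 0" "ereal r < 1"
  thus "\<exists>z. norm z = r \<and> summable (\<lambda>n. fps_one_minus_powr a $ n * z ^ n)"
    using sums_one_minus_powr[of "of_real r" a] by (intro exI[of _ "of_real r"]) (auto simp: sums_iff)
qed

text \<open>
  Euler's transformation
  \<open>\<^sub>2F\<^sub>1(-\<nu>, \<nu> + 1; \<mu> + 1; z) = (1 - z)\<^sup>\<mu> \<^sub>2F\<^sub>1(-n, n + 2\<mu> + 1; \<mu> + 1; z)\<close> for \<open>\<nu> = n + \<mu>\<close>:
  the formal power series on the right solves the hypergeometric equation of the series on the left.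
  Its coefficients therefore obey the same first-order recurrence.
\<close>
lemma euler_fps_ode:
  fixes \<mu> :: complex and n :: nat
  assumes "2 * \<mu> + 1 \<notin> \<int>\<^sub>\<le>\<^sub>0"
  defines "Y \<equiv> fps_one_minus_powr \<mu> * fps_of_poly (gegen_poly \<mu> n)" and "\<nu> \<equiv> of_nat n + \<mu>"
  shows "fps_X * (1 - fps_X) * fps_deriv (fps_deriv Y) + (fps_const (\<mu> + 1) - 2 * fps_X) * fps_deriv Y
           + fps_const (\<nu> * (\<nu> + 1)) * Y = 0"
proof -
  \<comment> \<open>Writing every factor as a multiple of \<open>B = (1 - X)\<^sup>\<mu>\<^sup>-\<^sup>2\<close> avoids all divisions; the left-hand
      side then is \<open>B (1 - X)\<^sup>2\<close> times the differential equation of \<open>gegen_poly\<close>.\<close>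
  define B where "B = fps_one_minus_powr (\<mu> - 1 - 1)"
  define G G' G'' where "G = fps_of_poly (gegen_poly \<mu> n)" and "G' = fps_deriv G" and "G'' = fps_deriv G'"
  define m N :: "complex fps" where "m = fps_const \<mu>" and "N = fps_const (of_nat n)"
  define X :: "complex fps" where "X = fps_X"
  have B1: "fps_one_minus_powr (\<mu> - 1) = (1 - X) * B"
    unfolding B_def X_def by (rule fps_one_minus_powr_rec)
  have B0: "fps_one_minus_powr \<mu> = (1 - X) * ((1 - X) * B)"
    using fps_one_minus_powr_rec[of \<mu>] B1 by (simp add: X_def)
  have D0: "fps_deriv (fps_one_minus_powr \<mu>) = - m * ((1 - X) * B)"
    by (simp add: fps_deriv_one_minus_powr B1 m_def)
  have D1: "fps_deriv ((1 - X) * B) = - (m - 1) * B"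
    using fps_deriv_one_minus_powr[of "\<mu> - 1"] B1 by (simp add: B_def m_def fps_const_sub flip: fps_const_1_eq_1)
  have Y: "Y = (1 - X) * ((1 - X) * B) * G" by (simp add: Y_def B0 G_def)
  have Dm: "fps_deriv (- m * ((1 - X) * B)) = m * (m - 1) * B"
    unfolding fps_deriv_mult[of "- m"] D1 by (simp add: m_def[THEN arg_cong[where f = fps_deriv]] algebra_simps)
  have D00: "fps_deriv ((1 - X) * ((1 - X) * B)) = - m * ((1 - X) * B)"
    using D0 B0 by simp
  have Y': "fps_deriv Y = - m * ((1 - X) * B) * G + (1 - X) * ((1 - X) * B) * G'"
    unfolding Y fps_deriv_mult[of _ G] D00 G'_def by (rule add.commute)
  have Y'': "fps_deriv (fps_deriv Y) = m * (m - 1) * B * G + 2 * (- m * ((1 - X) * B)) * G' + (1 - X) * ((1 - X) * B) * G''"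
    unfolding Y' fps_deriv_add fps_deriv_mult[of _ G] fps_deriv_mult[of _ G'] Dm D00
    by (simp add: G'_def G''_def algebra_simps)
  have ode: "X * (1 - X) * G'' + (m + 1) * ((1 - 2 * X) * G') + N * (N + 2 * m + 1) * G = 0"
  proof -
    have e: "fps_of_poly [:0, 1, -1:] = X * (1 - X)" "fps_of_poly [:1, -2:] = 1 - 2 * X"
      by (simp_all add: fps_of_poly_pCons X_def algebra_simps fps_const_neg[symmetric] flip: fps_const_neg)
    show ?thesis
      using arg_cong[OF gegen_poly_ode[OF assms(1), of n], of fps_of_poly]
      unfolding fps_of_poly_add fps_of_poly_mult fps_of_poly_smult e fps_of_poly_pderiv
      by (simp add: G_def G'_def G''_def m_def N_def fps_const_mult[symmetric] fps_const_add[symmetric] numeral_fps_const mult_ac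
               del: fps_const_mult fps_const_add)
  qed
  have c: "fps_const (\<mu> + 1) = m + 1" "fps_const (\<nu> * (\<nu> + 1)) = (N + m) * (N + m + 1)"
    by (simp_all add: m_def N_def \<nu>_def fps_const_mult[symmetric] fps_const_add[symmetric] 
               del: fps_const_mult fps_const_add)
  show ?thesis
    unfolding c X_def[symmetric]
    by (subst Y'', subst Y', subst Y) (use ode in algebra)
qed

lemma fps_hypergeom_ode_coeff:
  fixes \<mu> \<nu> :: complex
  assumes "fps_X * (1 - fps_X) * fps_deriv (fps_deriv Y) + (fps_const (\<mu> + 1) - 2 * fps_X) * fps_deriv Y
           + fps_const (\<nu> * (\<nu> + 1)) * Y = 0"
  shows "of_nat (Suc j) * (\<mu> + 1 + of_nat j) * Y $ Suc j = (of_nat j - \<nu>) * (of_nat j + \<nu> + 1) * Y $ j"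
proof -
  define J :: complex where "J = of_nat j"
  define a b where "a = Y $ j" and "b = Y $ Suc j"
  have 1: "(fps_X * (1 - fps_X) * fps_deriv (fps_deriv Y)) $ j = J * (J + 1) * b - J * (J - 1) * a"
  proof (cases j)
    case (Suc i)
    thus ?thesis
      by (cases i) (simp_all add: mult.assoc left_diff_distrib a_def b_def J_def algebra_simps)
  qed (simp add: J_def mult.assoc)
  have 2: "((fps_const (\<mu> + 1) - 2 * fps_X) * fps_deriv Y) $ j = (\<mu> + 1) * ((J + 1) * b) - 2 * J * a"
    by (cases j) (simp_all add: left_diff_distrib mult.assoc numeral_fps_const a_def b_def J_def algebra_simps)
  have "J * (J + 1) * b - J * (J - 1) * a + ((\<mu> + 1) * ((J + 1) * b) - 2 * J * a) + \<nu> * (\<nu> + 1) * a = 0"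
    using arg_cong[OF assms, of "\<lambda>F. F $ j"]
    by (simp only: fps_add_nth 1 2 fps_mult_left_const_nth a_def[symmetric] fps_zero_nth)
  hence "(J + 1) * (\<mu> + 1 + J) * b = (J - \<nu>) * (J + \<nu> + 1) * a" by algebra
  thus ?thesis by (simp add: a_def b_def J_def add.commute)
qed

lemma euler_fps_nth:
  fixes \<mu> :: complex and n :: nat
  assumes "2 * \<mu> + 1 \<notin> \<int>\<^sub>\<le>\<^sub>0"
  defines "\<nu> \<equiv> of_nat n + \<mu>"
  shows "(fps_one_minus_powr \<mu> * fps_of_poly (gegen_poly \<mu> n)) $ j =
           pochhammer (- \<nu>) j * pochhammer (\<nu> + 1) j / (pochhammer (\<mu> + 1) j * fact j)"
    (is "?Y $ j = ?H j")
proof (induction j)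
  case 0
  thus ?case by (simp add: fps_one_minus_powr_def coeff_gegen_poly)
next
  case (Suc j)
  have nz: "of_nat (Suc j) * (\<mu> + 1 + of_nat j) \<noteq> 0"
    using gegen_order_regular[OF assms(1)] by (auto simp del: of_nat_Suc)
  have "of_nat (Suc j) * (\<mu> + 1 + of_nat j) * ?Y $ Suc j = (of_nat j - \<nu>) * (of_nat j + \<nu> + 1) * ?H j"
    using fps_hypergeom_ode_coeff[OF euler_fps_ode[OF assms(1)]] Suc.IH unfolding \<nu>_def by metis
  also have "?H (Suc j) = ?H j * ((of_nat j - \<nu>) * (of_nat j + \<nu> + 1)) / (of_nat (Suc j) * (\<mu> + 1 + of_nat j))"
    unfolding pochhammer_Suc fact_Suc by (simp del: of_nat_Suc add: mult_ac add_ac)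
  hence "(of_nat j - \<nu>) * (of_nat j + \<nu> + 1) * ?H j = of_nat (Suc j) * (\<mu> + 1 + of_nat j) * ?H (Suc j)"
    using nz by (simp del: of_nat_Suc add: mult_ac)
  finally show ?case using nz by (metis mult_left_cancel)
qed

lemma Ferrers_P_eq_gegen:
  assumes "2 * \<mu> + 1 \<notin> \<int>\<^sub>\<le>\<^sub>0" and x: "x \<in> {-1<..<1}"
  shows "Ferrers_P (of_nat n + \<mu>) (- \<mu>) x =
           rGamma (\<mu> + 1) * 2 powr (- \<mu>) * of_real (1 - x\<^sup>2) powr (\<mu> / 2) * gegen \<mu> n x"
proof -
  define \<nu> where "\<nu> = of_nat n + \<mu>"
  define z where "z = complex_of_real ((1 - x) / 2)"
  have z: "norm z < 1" unfolding z_def norm_of_real using x by auto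
  have reg: "\<mu> + 1 \<notin> \<int>\<^sub>\<le>\<^sub>0" using gegen_order_regular[OF assms(1)] by simp
  have rG: "rGamma (\<mu> + 1 + of_nat j) = rGamma (\<mu> + 1) / pochhammer (\<mu> + 1) j" for j
    using reg by (simp add: pochhammer_Gamma rGamma_inverse_Gamma field_simps Gamma_eq_zero_iff)
  let ?Y = "fps_one_minus_powr \<mu> * fps_of_poly (gegen_poly \<mu> n)"
  have r: "ereal (norm z) < fps_conv_radius (fps_one_minus_powr \<mu>)"
    using fps_conv_radius_one_minus_powr[of \<mu>] z
    by (metis ereal_less(3) less_le_trans ereal_less_eq(3) one_ereal_def ereal_less_ereal_Ex less_ereal.simps(1))
  have "(\<lambda>j. ?Y $ j * z ^ j) sums eval_fps ?Y z"
    by (rule sums_eval_fps, rule less_le_trans[OF _ fps_conv_radius_mult]) (use r in auto)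
  also have "eval_fps ?Y z = (1 - z) powr \<mu> * gegen \<mu> n x"
  proof -
    have "eval_fps (fps_one_minus_powr \<mu>) z = (1 - z) powr \<mu>"
      using sums_unique[OF sums_one_minus_powr[OF z, of \<mu>]] by (simp add: eval_fps_def)
    thus ?thesis using r by (subst eval_fps_mult) (simp_all add: gegen_def z_def)
  qed
  finally have S: "(\<lambda>j. ?Y $ j * z ^ j) sums ((1 - z) powr \<mu> * gegen \<mu> n x)" .
  have "(\<lambda>j. rGamma (\<mu> + 1) * (?Y $ j * z ^ j)) sums (rGamma (\<mu> + 1) * ((1 - z) powr \<mu> * gegen \<mu> n x))"
    by (rule sums_mult[OF S])
  also have "(\<lambda>j. rGamma (\<mu> + 1) * (?Y $ j * z ^ j)) =
     (\<lambda>j. pochhammer (- \<nu>) j * pochhammer (\<nu> + 1) j * rGamma (- (- \<mu>) + 1 + of_nat j) / fact j * z ^ j)"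
    unfolding euler_fps_nth[OF assms(1)] minus_minus rG \<nu>_def by (simp add: mult_ac)
  finally have "Ferrers_P (of_nat n + \<mu>) (- \<mu>) x = complex_of_real ((1 - x) / (1 + x)) powr (\<mu> / 2) * 
       (rGamma (\<mu> + 1) * ((1 - z) powr \<mu> * gegen \<mu> n x))"
    unfolding Ferrers_P_def \<nu>_def z_def by (simp add: sums_iff)
  moreover have "complex_of_real ((1 - x) / (1 + x)) powr (\<mu> / 2) * (1 - z) powr \<mu> =
      2 powr (- \<mu>) * of_real (1 - x\<^sup>2) powr (\<mu> / 2)"
  proof -
    have z': "1 - z = of_real ((1 + x) / 2)" by (simp add: z_def field_simps)
    have pos: "1 - x > 0" "1 + x > 0" using x by auto
    have fac: "1 - x\<^sup>2 = (1 - x) * (1 + x)" by (simp add: power2_eq_square algebra_simps)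
    have "1 - x\<^sup>2 > 0" unfolding fac using pos by simp
    have P: "of_real t powr a = exp (a * of_real (ln t))" if "t > 0" for t and a :: complex
      using that by (simp add: powr_def Ln_of_real)
    have two: "(2 :: complex) = of_real 2" by simp
    show ?thesis
      unfolding z' two using pos \<open>1 - x\<^sup>2 > 0\<close>
      by (simp only: P divide_pos_pos zero_less_numeral exp_add[symmetric] ln_div ln_mult fac)
         (simp add: algebra_simps add_divide_distrib diff_divide_distrib)
  qed
  ultimately show ?thesis by (simp add: mult_ac)
qed

section \<open>Polynomial growth of the Gegenbauer polynomials\<close>

text \<open>
  By Bernoulli's inequality \<open>1 + m / (n + 1) \<le> ((n + 2) / (n + 1))\<^sup>m\<close>, so the product of the ratios telescopes.
\<close>
lemma growth_of_ratio_bound: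
  fixes u :: "nat \<Rightarrow> complex"
  assumes "\<And>n. norm (u (Suc n)) \<le> (1 + real m / real (n + 1)) * norm (u n)"
  shows "norm (u n) \<le> norm (u 0) * real (n + 1) ^ m"
proof (induction n)
  case (Suc n)
  have "1 + real m / real (n + 1) \<le> (1 + 1 / real (n + 1)) ^ m"
    using Bernoulli_inequality[of "1 / real (n + 1)" m] order.trans[of "-1" 0 "1 / real (n + 1)"]
    by simp
  also have "1 + 1 / real (n + 1) = real (Suc n + 1) / real (n + 1)" by (simp add: field_simps)
  finally have "norm (u (Suc n)) \<le> (real (Suc n + 1) / real (n + 1)) ^ m * (norm (u 0) * real (n + 1) ^ m)"
    by (intro order.trans[OF assms] mult_mono Suc.IH) auto
  also have "\<dots> = norm (u 0) * real (Suc n + 1) ^ m"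
    by (simp add: power_divide)
  finally show ?case .
qed auto

lemma norm_add_of_nat_lower:
  fixes z :: complex
  assumes "z \<notin> \<int>\<^sub>\<le>\<^sub>0"
  obtains \<delta> where "\<delta> > 0" "\<And>n. \<delta> * real (n + 1) \<le> norm (z + of_nat n)"
proof -
  have nz: "z + of_nat n \<noteq> 0" for n
    using assms by (metis add_eq_0_iff2 minus_of_nat_in_nonpos_Ints)
  have "(\<lambda>n. 1 + (z - 1) * (1 / of_nat (Suc n))) \<longlonglongrightarrow> 1 + (z - 1) * 0"
    by (intro tendsto_intros LIMSEQ_Suc[OF lim_1_over_n])
  also have "(\<lambda>n. 1 + (z - 1) * (1 / of_nat (Suc n))) = (\<lambda>n. (z + of_nat n) / of_nat (Suc n))"
    by (simp add: fun_eq_iff field_simps del: of_nat_Suc) simp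
  finally have "(\<lambda>n. inverse ((z + of_nat n) / of_nat (Suc n))) \<longlonglongrightarrow> inverse 1"
    by (intro tendsto_inverse) auto
  hence "Bseq (\<lambda>n. inverse ((z + of_nat n) / of_nat (Suc n)))"
    by (intro convergent_imp_Bseq convergentI)
  then obtain K where K: "K > 0" "\<And>n. norm (inverse ((z + of_nat n) / of_nat (Suc n))) \<le> K"
    unfolding Bseq_def by blast
  show ?thesis
  proof (rule that[of "1 / K"])
    fix n
    have "real (Suc n) / norm (z + of_nat n) \<le> K"
      using K(2)[of n] by (simp add: norm_divide norm_inverse del: of_nat_Suc)
    thus "1 / K * real (n + 1) \<le> norm (z + of_nat n)"
      using K(1) nz[of n] by (simp add: field_simps)
  qed (use K in auto)
qed

lemma pochhammer_over_fact_growth: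
  obtains m where "\<And>n. norm (pochhammer (a :: complex) n / fact n) \<le> real (n + 1) ^ m"
proof -
  obtain m where m: "real m \<ge> norm a" using real_arch_simple by blast
  have "norm (pochhammer a n / fact n) \<le> norm (pochhammer a 0 / fact 0) * real (n + 1) ^ m" for n
  proof (rule growth_of_ratio_bound)
    fix n
    have "norm ((a + of_nat n) / of_nat (Suc n)) \<le> (real m + real n) / real (n + 1)"
      unfolding norm_divide norm_of_nat using m
      by (intro frac_le order.trans[OF norm_triangle_ineq]) auto
    also have "\<dots> \<le> 1 + real m / real (n + 1)" by (simp add: field_simps)
    finally have "norm ((a + of_nat n) / of_nat (Suc n)) * norm (pochhammer a n / fact n)
       \<le> (1 + real m / real (n + 1)) * norm (pochhammer a n / fact n)"
      by (intro mult_right_mono) auto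
    also have "norm ((a + of_nat n) / of_nat (Suc n)) * norm (pochhammer a n / fact n) = norm (pochhammer a (Suc n) / fact (Suc n))"
      unfolding norm_mult[symmetric] pochhammer_Suc fact_Suc by (simp add: mult_ac del: of_nat_Suc)
    finally show "norm (pochhammer a (Suc n) / fact (Suc n)) \<le> (1 + real m / real (n + 1)) * norm (pochhammer a n / fact n)" .
  qed
  thus ?thesis by (intro that[of m]) simp
qed

lemma fact_over_pochhammer_growth:
  assumes "(a :: complex) \<notin> \<int>\<^sub>\<le>\<^sub>0"
  obtains m where "\<And>n. norm (fact n / pochhammer a n) \<le> real (n + 1) ^ m"
proof -
  obtain \<delta> where \<delta>: "\<delta> > 0" "\<And>n. \<delta> * real (n + 1) \<le> norm (a + of_nat n)"
    using norm_add_of_nat_lower[OF assms] by blast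
  obtain m where m: "real m \<ge> norm (1 - a) / \<delta>" using real_arch_simple by blast
  have "norm (fact n / pochhammer a n) \<le> norm (fact 0 / pochhammer a 0) * real (n + 1) ^ m" for n
  proof (rule growth_of_ratio_bound)
    fix n
    have pos: "0 < \<delta> * real (n + 1)" using \<delta>(1) by simp
    hence nz: "a + of_nat n \<noteq> 0" using \<delta>(2)[of n] by auto
    have "of_nat (Suc n) / (a + of_nat n) = 1 + (1 - a) / (a + of_nat n)" using nz by (simp add: field_simps)
    hence "norm (of_nat (Suc n) / (a + of_nat n)) \<le> 1 + norm (1 - a) / norm (a + of_nat n)"
      by (metis norm_divide norm_one norm_triangle_ineq)
    also have "\<dots> \<le> 1 + norm (1 - a) / (\<delta> * real (n + 1))"
      using \<delta>(2) by (intro add_left_mono divide_left_mono mult_pos_pos) (use nz pos \<delta>(1) in auto)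
    also have "\<dots> = 1 + (norm (1 - a) / \<delta>) / real (n + 1)" by simp
    also have "\<dots> \<le> 1 + real m / real (n + 1)"
      using m by (intro add_left_mono divide_right_mono) auto
    finally have "norm (of_nat (Suc n) / (a + of_nat n)) * norm (fact n / pochhammer a n)
       \<le> (1 + real m / real (n + 1)) * norm (fact n / pochhammer a n)"
      by (intro mult_right_mono) auto
    also have "norm (of_nat (Suc n) / (a + of_nat n)) * norm (fact n / pochhammer a n) = norm (fact (Suc n) / pochhammer a (Suc n))"
      unfolding norm_mult[symmetric] pochhammer_Suc fact_Suc by (simp add: mult_ac del: of_nat_Suc)
    finally show "norm (fact (Suc n) / pochhammer a (Suc n)) \<le> (1 + real m / real (n + 1)) * norm (fact n / pochhammer a n)" .
  qed
  thus ?thesis by (intro that[of m]) simp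
qed

text \<open>
  The binomial series of \<open>(1 - e t)\<^sup>-\<^sup>\<alpha>\<close> in the variable \<open>t\<close>.
\<close>
definition fps_geom_powr :: "complex \<Rightarrow> complex \<Rightarrow> complex fps" where
  "fps_geom_powr \<alpha> e = Abs_fps (\<lambda>k. pochhammer \<alpha> k / fact k * e ^ k)"

lemma fps_geom_powr_ode:
  "(1 - fps_const e * fps_X) * fps_deriv (fps_geom_powr \<alpha> e) = fps_const (\<alpha> * e) * fps_geom_powr \<alpha> e"
proof (rule fps_ext)
  fix k
  have *: "of_nat (Suc k) * (pochhammer \<alpha> (Suc k) / fact (Suc k)) = (\<alpha> + of_nat k) * (pochhammer \<alpha> k / fact k)" for k
    unfolding pochhammer_Suc fact_Suc by (simp del: of_nat_Suc)
  have D: "fps_deriv (fps_geom_powr \<alpha> e) $ k = (\<alpha> + of_nat k) * (pochhammer \<alpha> k / fact k) * e ^ Suc k" for k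
    using *[of k] by (simp add: fps_geom_powr_def mult.assoc del: of_nat_Suc)
  show "((1 - fps_const e * fps_X) * fps_deriv (fps_geom_powr \<alpha> e)) $ k = (fps_const (\<alpha> * e) * fps_geom_powr \<alpha> e) $ k"
  proof (cases k)
    case 0
    thus ?thesis using D[of 0] by (simp add: left_diff_distrib mult.assoc fps_geom_powr_def)
  next
    case (Suc j)
    have "((1 - fps_const e * fps_X) * fps_deriv (fps_geom_powr \<alpha> e)) $ k
        = fps_deriv (fps_geom_powr \<alpha> e) $ k - e * fps_deriv (fps_geom_powr \<alpha> e) $ j"
      unfolding Suc by (simp add: left_diff_distrib mult.assoc del: fps_deriv_nth)
    also have "\<dots> = (\<alpha> + of_nat k) * (pochhammer \<alpha> k / fact k) * e ^ Suc k - of_nat k * (pochhammer \<alpha> k / fact k) * e ^ Suc k"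
      unfolding D using *[of j] by (simp add: Suc mult_ac del: of_nat_Suc)
    also have "\<dots> = (fps_const (\<alpha> * e) * fps_geom_powr \<alpha> e) $ k"
      by (simp add: fps_geom_powr_def algebra_simps add_divide_distrib)
    finally show ?thesis .
  qed
qed

text \<open>
  The classical generating function
  \<open>(1 - 2 t cos \<theta> + t\<^sup>2)\<^sup>-\<^sup>\<alpha> = (1 - t e\<^sup>i\<^sup>\<theta>)\<^sup>-\<^sup>\<alpha> (1 - t e\<^sup>-\<^sup>i\<^sup>\<theta>)\<^sup>-\<^sup>\<alpha>\<close> with \<open>\<alpha> = \<mu> + 1/2\<close>. Both sides of the
  claim satisfy the same second-order recurrence. The factorised form gives a polynomial bound
  for \<open>p\<^sub>n\<close> on all of \<open>[-1, 1]\<close> and for every complex \<open>\<mu>\<close> at once.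
\<close>
lemma gegen_generating_function:
  fixes \<mu> :: complex and \<theta> :: real
  assumes reg: "2 * \<mu> + 1 \<notin> \<int>\<^sub>\<le>\<^sub>0"
  shows "(fps_geom_powr (\<mu> + 1 / 2) (cis \<theta>) * fps_geom_powr (\<mu> + 1 / 2) (cis (- \<theta>))) $ n =
    pochhammer (2 * \<mu> + 1) n / fact n * gegen \<mu> n (cos \<theta>)"
proof -
  define \<alpha> where "\<alpha> = \<mu> + 1 / 2"
  define x where "x = complex_of_real (cos \<theta>)"
  define F G where "F = fps_geom_powr \<alpha> (cis \<theta>)" and "G = fps_geom_powr \<alpha> (cis (- \<theta>))"
  define H where "H = F * G"
  define C where "C n = pochhammer (2 * \<mu> + 1) n / fact n * gegen \<mu> n (cos \<theta>)" for n
  define a b L :: "complex fps" where "a = fps_const (cis \<theta>)" and "b = fps_const (cis (-\<theta>))" and "L = fps_const \<alpha>"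
  have ab: "a * b = 1" by (simp add: a_def b_def cis_mult)
  have apb: "a + b = fps_const (2 * x)"
    by (simp add: a_def b_def x_def complex_eq_iff)
  have 1: "(1 - a * fps_X) * fps_deriv F = L * a * F" and 2: "(1 - b * fps_X) * fps_deriv G = L * b * G"
    unfolding a_def b_def L_def F_def G_def by (simp_all add: fps_geom_powr_ode)
  have "(1 - (a + b) * fps_X + (a * b) * fps_X * fps_X) * fps_deriv H = L * ((a + b) - 2 * (a * b) * fps_X) * H"
  proof -
    have "(1 - (a + b) * fps_X + (a * b) * fps_X * fps_X) * fps_deriv H =
      ((1 - a * fps_X) * fps_deriv F) * (1 - b * fps_X) * G + ((1 - b * fps_X) * fps_deriv G) * (1 - a * fps_X) * F"
      unfolding H_def fps_deriv_mult by algebra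
    also have "\<dots> = L * ((a + b) - 2 * (a * b) * fps_X) * H" unfolding 1 2 H_def by algebra
    finally show ?thesis .
  qed
  hence ode: "(1 - fps_const (2 * x) * fps_X + fps_X * fps_X) * fps_deriv H = L * (fps_const (2 * x) - 2 * fps_X) * H"
    unfolding ab apb by simp
  have H0: "H $ 0 = 1" by (simp add: H_def F_def G_def fps_geom_powr_def)
  have H1: "H $ 1 = 2 * \<alpha> * x"
    using arg_cong[OF ode, of "\<lambda>f. f $ 0"] H0 by (simp add: mult.assoc distrib_right left_diff_distrib L_def)
  have Hrec: "of_nat (Suc (Suc m)) * H $ Suc (Suc m) = 2 * x * (of_nat (Suc m) + \<alpha>) * H $ Suc m - (of_nat m + 2 * \<alpha>) * H $ m" for m
  proof -
    have "((1 - fps_const (2 * x) * fps_X + fps_X * fps_X) * fps_deriv H) $ Suc m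
        = of_nat (Suc (Suc m)) * H $ Suc (Suc m) - 2 * x * of_nat (Suc m) * H $ Suc m + of_nat m * H $ m"
      by (cases m) (simp_all add: mult.assoc distrib_right left_diff_distrib)
    moreover have "(L * (fps_const (2 * x) - 2 * fps_X) * H) $ Suc m = 2 * \<alpha> * x * H $ Suc m - 2 * \<alpha> * H $ m"
      by (simp add: mult.assoc left_diff_distrib L_def numeral_fps_const algebra_simps)
    ultimately have "of_nat (Suc (Suc m)) * H $ Suc (Suc m) - 2 * x * of_nat (Suc m) * H $ Suc m + of_nat m * H $ m
      = 2 * \<alpha> * x * H $ Suc m - 2 * \<alpha> * H $ m" using ode by simp
    thus ?thesis by algebra
  qed
  have C0: "C 0 = 1" by (simp add: C_def)
  have C1: "C 1 = 2 * \<alpha> * x" using gegen_1[OF reg] by (simp add: C_def \<alpha>_def x_def algebra_simps)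
  have Crec: "of_nat (Suc (Suc m)) * C (Suc (Suc m)) = 2 * x * (of_nat (Suc m) + \<alpha>) * C (Suc m) - (of_nat m + 2 * \<alpha>) * C m" for m
  proof -
    define g0 g1 g2 where "g0 = gegen \<mu> m (cos \<theta>)" and "g1 = gegen \<mu> (Suc m) (cos \<theta>)" and "g2 = gegen \<mu> (Suc (Suc m)) (cos \<theta>)"
    define M c where "M = (of_nat (Suc m) :: complex)" and "c = 2 * \<mu> + 1"
    define p where "p = pochhammer c m / fact m"
    have M: "M \<noteq> 0" by (simp add: M_def del: of_nat_Suc)
    have p1: "pochhammer c (Suc m) / fact (Suc m) = p * (c + M - 1) / M"
      unfolding pochhammer_Suc fact_Suc M_def p_def by (simp add: mult_ac)
    have p2: "of_nat (Suc (Suc m)) * (pochhammer c (Suc (Suc m)) / fact (Suc (Suc m))) = p * (c + M - 1) / M * (c + M)"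
      unfolding pochhammer_Suc[of _ "Suc m"] fact_Suc[of "Suc m"] M_def[symmetric] p1[symmetric]
      by (simp add: mult_ac M_def[symmetric] del: of_nat_Suc fact_Suc)
    have rec: "(M + c) * g2 + M * g0 = (2 * M + c) * x * g1"
      using gegen_rec[OF reg, of m "cos \<theta>"] by (simp add: g0_def g1_def g2_def M_def c_def x_def add_ac)
    have "of_nat (Suc (Suc m)) * C (Suc (Suc m)) = p * (c + M - 1) / M * ((c + M) * g2)"
    proof -
      have "of_nat (Suc (Suc m)) * C (Suc (Suc m)) =
          of_nat (Suc (Suc m)) * (pochhammer c (Suc (Suc m)) / fact (Suc (Suc m))) * g2"
        by (simp only: C_def g2_def c_def mult.assoc)
      thus ?thesis unfolding p2 by (simp only: mult.assoc)
    qed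
    also have "(c + M) * g2 = (2 * M + c) * x * g1 - M * g0" using rec by algebra
    also have "p * (c + M - 1) / M * ((2 * M + c) * x * g1 - M * g0) =
       2 * x * (M + c / 2) * (p * (c + M - 1) / M * g1) - (c + M - 1) * (p * g0)"
      using M by (simp add: field_simps)
    also have "\<dots> = 2 * x * (of_nat (Suc m) + \<alpha>) * C (Suc m) - (of_nat m + 2 * \<alpha>) * C m"
    proof -
      have "C (Suc m) = p * (c + M - 1) / M * g1" using p1 by (simp add: C_def c_def g1_def)
      moreover have "C m = p * g0" by (simp add: C_def p_def c_def g0_def)
      moreover have "c + M - 1 = of_nat m + 2 * \<alpha>" "M + c / 2 = of_nat (Suc m) + \<alpha>"
        by (simp_all add: c_def M_def \<alpha>_def field_simps)
      ultimately show ?thesis by simp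
    qed
    finally show ?thesis .
  qed
  have "H $ n = C n"
  proof (induction n rule: induct_nat_012)
    case (ge2 m)
    have "of_nat (Suc (Suc m)) * H $ Suc (Suc m) = of_nat (Suc (Suc m)) * C (Suc (Suc m))"
      unfolding Hrec Crec ge2 ..
    thus ?case by (simp del: of_nat_Suc)
  qed (use H0 H1 C0 C1 in auto)
  thus ?thesis by (simp add: H_def F_def G_def \<alpha>_def C_def)
qed

lemma gegen_growth:
  fixes \<mu> :: complex
  assumes reg: "2 * \<mu> + 1 \<notin> \<int>\<^sub>\<le>\<^sub>0"
  obtains A where "\<And>n x. x \<in> {-1..1} \<Longrightarrow> norm (gegen \<mu> n x) \<le> real (n + 1) ^ A"
proof -
  obtain m where m: "\<And>n. norm (pochhammer (\<mu> + 1 / 2) n / fact n) \<le> real (n + 1) ^ m"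
    using pochhammer_over_fact_growth by blast
  obtain k where k: "\<And>n. norm (fact n / pochhammer (2 * \<mu> + 1) n) \<le> real (n + 1) ^ k"
    using fact_over_pochhammer_growth[OF reg] by blast
  have nz: "pochhammer (2 * \<mu> + 1) n \<noteq> 0" for n
    using reg by (auto simp: pochhammer_eq_0_iff)
  have "norm (gegen \<mu> n x) \<le> real (n + 1) ^ (k + (m + m + 1))" if x: "x \<in> {-1..1}" for n x
  proof -
    define \<theta> where "\<theta> = arccos x"
    have \<theta>: "cos \<theta> = x" using x by (simp add: \<theta>_def)
    let ?F = "fps_geom_powr (\<mu> + 1 / 2) (cis \<theta>)" and ?G = "fps_geom_powr (\<mu> + 1 / 2) (cis (-\<theta>))"
    have b: "norm (?F $ i) \<le> real (n + 1) ^ m" "norm (?G $ i) \<le> real (n + 1) ^ m" if "i \<le> n" for i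
    proof -
      have "real (i + 1) ^ m \<le> real (n + 1) ^ m" using that by (intro power_mono) auto
      thus "norm (?F $ i) \<le> real (n + 1) ^ m" "norm (?G $ i) \<le> real (n + 1) ^ m"
        using m[of i] by (simp_all add: fps_geom_powr_def norm_mult norm_power norm_divide)
    qed
    have "norm ((?F * ?G) $ n) \<le> (\<Sum>i=0..n. norm (?F $ i * ?G $ (n - i)))"
      unfolding fps_mult_nth by (rule norm_sum)
    also have "\<dots> \<le> (\<Sum>i=0..n. real (n + 1) ^ m * real (n + 1) ^ m)"
      unfolding norm_mult by (intro sum_mono mult_mono b) auto
    also have "\<dots> = real (n + 1) ^ (m + m + 1)" by (simp add: power_add)
    finally have H: "norm ((?F * ?G) $ n) \<le> real (n + 1) ^ (m + m + 1)" .
    have "gegen \<mu> n x = fact n / pochhammer (2 * \<mu> + 1) n * (?F * ?G) $ n"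
      unfolding gegen_generating_function[OF reg] \<theta> using nz[of n] by simp
    hence "norm (gegen \<mu> n x) = norm (fact n / pochhammer (2 * \<mu> + 1) n) * norm ((?F * ?G) $ n)"
      by (simp add: norm_mult norm_divide)
    also have "\<dots> \<le> real (n + 1) ^ k * real (n + 1) ^ (m + m + 1)"
      by (intro mult_mono k H) auto
    finally show ?thesis by (simp only: power_add mult.assoc)
  qed
  thus ?thesis using that by blast
qed

section \<open>Smooth functions\<close>

text \<open>
  The derivative as an operator on functions, as it is iterated in \<^const>\<open>smooth\<close>.
\<close>
definition vderiv :: "(real \<Rightarrow> complex) \<Rightarrow> real \<Rightarrow> complex" where
  "vderiv f x = vector_derivative f (at x)"

text \<open>
  \<open>f\<close> is \<open>k\<close> times differentiable on the whole real line. This form of finite differentiability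
  lends itself to induction on \<open>k\<close>.
\<close>
primrec times_differentiable :: "nat \<Rightarrow> (real \<Rightarrow> complex) \<Rightarrow> bool" where
  "times_differentiable 0 f \<longleftrightarrow> True"
| "times_differentiable (Suc k) f \<longleftrightarrow>
     (\<exists>f'. (\<forall>x. (f has_vector_derivative f' x) (at x)) \<and> times_differentiable k f')"

lemma smooth_vderiv:
  assumes "smooth f"
  shows "(f has_vector_derivative vderiv f x) (at x)" "smooth (vderiv f)"
proof -
  have *: "((\<lambda>g t. vector_derivative g (at t)) ^^ k) f differentiable (at x)" for k x
    using assms by (auto simp: smooth_def)
  show "(f has_vector_derivative vderiv f x) (at x)"
    using *[of 0 x] by (simp add: vderiv_def vector_derivative_works)
  have "((\<lambda>g t. vector_derivative g (at t)) ^^ k) (vderiv f) differentiable (at x)" for k x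
    using *[of "Suc k" x] by (simp add: funpow_Suc_right vderiv_def[abs_def] del: funpow.simps)
  thus "smooth (vderiv f)" unfolding smooth_def by blast
qed

lemma times_differentiable_if_smooth: "smooth f \<Longrightarrow> times_differentiable k f"
proof (induction k arbitrary: f)
  case (Suc k)
  thus ?case using smooth_vderiv[OF Suc.prems] by auto
qed auto

lemma smooth_iff: "smooth f \<longleftrightarrow> (\<forall>k. times_differentiable k f)"
proof
  assume *: "\<forall>k. times_differentiable k f"
  have "f differentiable (at x) \<and> (\<forall>k. times_differentiable k (\<lambda>t. vector_derivative f (at t)))"
    if f: "\<forall>k. times_differentiable k f" for f :: "real \<Rightarrow> complex" and x
  proof (intro conjI allI)
    fix k
    obtain f' where f': "\<forall>x. (f has_vector_derivative f' x) (at x)" "times_differentiable k f'"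
      using f[rule_format, of "Suc k"] by auto
    hence "(\<lambda>t. vector_derivative f (at t)) = f'" by (auto intro!: vector_derivative_at)
    with f' show "times_differentiable k (\<lambda>t. vector_derivative f (at t))" by simp
    show "f differentiable (at x)" using f' by (metis differentiableI_vector)
  qed
  note step = this
  have "\<forall>j. times_differentiable j (((\<lambda>g t. vector_derivative g (at t)) ^^ k) f)" for k
    by (induction k) (use * step in auto)
  thus "smooth f" unfolding smooth_def using step by blast
qed (auto intro: times_differentiable_if_smooth)

lemma times_differentiable_decrease:
  "times_differentiable (Suc k) f \<Longrightarrow> times_differentiable k f"
proof (induction k arbitrary: f)
  case (Suc k)
  from Suc.prems obtain f' where "\<forall>x. (f has_vector_derivative f' x) (at x)" "times_differentiable (Suc k) f'"
    by (subst (asm) times_differentiable.simps) blast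
  thus ?case using Suc.IH[of f'] by auto
qed auto

lemma smooth_const: "smooth (\<lambda>_. c)"
  unfolding smooth_iff
proof
  fix k show "times_differentiable k (\<lambda>_. c)"
    by (induction k arbitrary: c) (auto intro!: exI[of _ "\<lambda>_. 0"] has_vector_derivative_const)
qed

lemma smooth_of_real: "smooth of_real"
  unfolding smooth_iff
proof
  fix k show "times_differentiable k of_real"
  proof (cases k)
    case (Suc j)
    have "(of_real has_vector_derivative 1) (at x)" for x
      using has_vector_derivative_of_real[of "\<lambda>x. x" 1] by simp
    thus ?thesis using Suc smooth_const[of 1] by (auto simp: smooth_iff intro!: exI[of _ "\<lambda>_. 1"])
  qed auto
qed

lemma times_differentiable_add:
  "times_differentiable k f \<Longrightarrow> times_differentiable k g \<Longrightarrow> times_differentiable k (\<lambda>x. f x + g x)"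
proof (induction k arbitrary: f g)
  case (Suc k)
  from Suc.prems obtain f' g' where *: "\<forall>x. (f has_vector_derivative f' x) (at x)" "times_differentiable k f'"
    "\<forall>x. (g has_vector_derivative g' x) (at x)" "times_differentiable k g'" by auto
  show ?case using * Suc.IH[of f' g'] 
    by (auto intro!: exI[of _ "\<lambda>x. f' x + g' x"] has_vector_derivative_add)
qed auto

lemma smooth_add: "smooth f \<Longrightarrow> smooth g \<Longrightarrow> smooth (\<lambda>x. f x + g x)"
  by (auto simp: smooth_iff intro: times_differentiable_add)

lemma smooth_mult:
  assumes "smooth f" "smooth g"
  shows "smooth (\<lambda>x. f x * g x)"
proof -
  have "times_differentiable k f \<Longrightarrow> times_differentiable k g \<Longrightarrow> times_differentiable k (\<lambda>x. f x * g x)" for k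
  proof (induction k arbitrary: f g)
    case (Suc k)
    from Suc.prems obtain f' g' where *: "\<forall>x. (f has_vector_derivative f' x) (at x)" "times_differentiable k f'"
      "\<forall>x. (g has_vector_derivative g' x) (at x)" "times_differentiable k g'" by auto
    have "times_differentiable k (\<lambda>x. f x * g' x)" "times_differentiable k (\<lambda>x. f' x * g x)"
      using * Suc.prems[THEN times_differentiable_decrease] by (auto intro: Suc.IH)
    hence "times_differentiable k (\<lambda>x. f x * g' x + f' x * g x)" by (rule times_differentiable_add)
    thus ?case using * 
      by (auto intro!: exI[of _ "\<lambda>x. f x * g' x + f' x * g x"] has_vector_derivative_mult)
  qed auto
  thus ?thesis using assms by (auto simp: smooth_iff)
qed

lemma smooth_diff:
  assumes "smooth f" "smooth g"
  shows "smooth (\<lambda>x. f x - g x)"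
  using smooth_add[OF assms(1) smooth_mult[OF smooth_const[of "-1"] assms(2)]] by simp

lemma smooth_one_minus_sq: "smooth (\<lambda>x. complex_of_real (1 - x\<^sup>2))"
  using smooth_diff[OF smooth_const[of 1] smooth_mult[OF smooth_of_real smooth_of_real]]
  by (simp add: power2_eq_square)

lemmas smooth_intros = smooth_const smooth_of_real smooth_add smooth_mult smooth_diff smooth_one_minus_sq smooth_vderiv(2)

lemma smooth_poly_half: "smooth (\<lambda>x. poly q (complex_of_real ((1 - x) / 2)))"
  unfolding smooth_iff
proof
  fix k show "times_differentiable k (\<lambda>x. poly q (complex_of_real ((1 - x) / 2)))"
  proof (induction k arbitrary: q)
    case (Suc k)
    have "times_differentiable k (\<lambda>x. poly (smult (- 1 / 2) (pderiv q)) (complex_of_real ((1 - x) / 2)))"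
      by (rule Suc.IH)
    thus ?case using has_vector_derivative_poly_half[of q]
      by (auto intro!: exI[of _ "\<lambda>x. - poly (pderiv q) (complex_of_real ((1 - x) / 2)) / 2"])
  qed auto
qed

lemma smooth_gegen: "smooth (gegen \<mu> n)"
  using smooth_poly_half by (simp add: gegen_def[abs_def])

lemma smooth_gegen_deriv: "smooth (gegen_deriv \<mu> n)"
  using smooth_mult[OF smooth_const[of "- 1 / 2"] smooth_poly_half] by (simp add: gegen_deriv_def[abs_def])

lemma continuous_on_smooth: "smooth f \<Longrightarrow> continuous_on A f"
  by (rule continuous_on_vector_derivative, rule has_vector_derivative_at_within, rule smooth_vderiv)

lemma continuous_smooth_compose:
  "smooth f \<Longrightarrow> continuous_on A g \<Longrightarrow> continuous_on A (\<lambda>x. f (g x))"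
  using continuous_on_compose2[OF continuous_on_smooth[of f UNIV]] by auto

text \<open>
  Hadamard's lemma: \<open>g(x) = \<integral>\<^sub>0\<^sup>1 h'(y + t (x - y)) dt\<close>, differentiated under the integral sign.
\<close>
lemma hadamard_quotient:
  assumes "smooth h" and h0: "h y = 0"
  obtains g where "smooth g" "\<And>x. h x = of_real (x - y) * g x"
proof -
  define D where "D k = (vderiv ^^ k) h" for k
  have sm: "smooth (D k)" for k
    by (induction k) (use assms in \<open>auto simp: D_def intro: smooth_vderiv\<close>)
  have D: "(D k has_vector_derivative D (Suc k) x) (at x)" for k x
    using smooth_vderiv(1)[OF sm[of k]] by (simp add: D_def)
  define g where "g k x = integral {0..1} (\<lambda>t. of_real t ^ k * D (Suc k) (y + t * (x - y)))" for k x
  have g: "(g k has_vector_derivative g (Suc k) x) (at x)" for k x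
  proof -
    have "((\<lambda>x. integral (cbox 0 1) (\<lambda>t. of_real t ^ k * D (Suc k) (y + t * (x - y)))) has_vector_derivative
        integral (cbox 0 1) (\<lambda>t. of_real t ^ Suc k * D (Suc (Suc k)) (y + t * (x - y)))) (at x within UNIV)"
    proof (rule leibniz_rule_vector_derivative)
      fix x t :: real
      have "((\<lambda>x. y + t * (x - y)) has_vector_derivative t) (at x)"
        by (rule derivative_eq_intros refl | simp)+
      from vector_diff_chain_at[OF this D, of "Suc k"]
      have "((\<lambda>x. D (Suc k) (y + t * (x - y))) has_vector_derivative of_real t * D (Suc (Suc k)) (y + t * (x - y))) (at x)"
        by (simp add: o_def scaleR_conv_of_real)
      from has_vector_derivative_mult_right[OF this, of "of_real t ^ k"]
      show "((\<lambda>x. of_real t ^ k * D (Suc k) (y + t * (x - y))) has_vector_derivative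
          of_real t ^ Suc k * D (Suc (Suc k)) (y + t * (x - y))) (at x within UNIV)"
        by (simp add: mult_ac)
    next
      fix x
      show "(\<lambda>t. of_real t ^ k * D (Suc k) (y + t * (x - y))) integrable_on cbox 0 1"
        by (intro integrable_continuous continuous_intros continuous_smooth_compose[OF sm])
    next
      show "continuous_on (UNIV \<times> cbox 0 1) (\<lambda>(x, t). complex_of_real t ^ Suc k * D (Suc (Suc k)) (y + t * (x - y)))"
        unfolding case_prod_beta
        by (intro continuous_intros continuous_smooth_compose[OF sm])
    qed auto
    thus ?thesis by (simp add: g_def[abs_def])
  qed
  have "times_differentiable j (g k)" for j k
    by (induction j arbitrary: k) (use g in auto)
  hence "smooth (g 0)" by (simp add: smooth_iff)
  moreover have "h x = of_real (x - y) * g 0 x" for x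
  proof -
    have "((\<lambda>t. of_real (x - y) * D 1 (y + t * (x - y))) has_integral (h (y + 1 * (x - y)) - h (y + 0 * (x - y)))) {0..1}"
    proof (rule fundamental_theorem_of_calculus)
      fix t :: real
      have "((\<lambda>t. y + t * (x - y)) has_vector_derivative (x - y)) (at t)"
        by (rule derivative_eq_intros refl | simp)+
      note chain = vector_diff_chain_at[OF this D, of 0]
      show "((\<lambda>t. h (y + t * (x - y))) has_vector_derivative of_real (x - y) * D 1 (y + t * (x - y))) (at t within {0..1})"
        by (rule has_vector_derivative_at_within) (use chain in \<open>simp add: o_def scaleR_conv_of_real D_def\<close>)
    qed auto
    hence "integral {0..1} (\<lambda>t. of_real (x - y) * D 1 (y + t * (x - y))) = h (y + 1 * (x - y)) - h (y + 0 * (x - y))"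
      by (rule integral_unique)
    thus ?thesis by (simp add: g_def h0)
  qed
  ultimately show ?thesis using that by blast
qed

section \<open>The Gegenbauer weight and admissible functions\<close>

text \<open>
  The Gegenbauer weight \<open>(1 - x\<^sup>2)\<^sup>\<mu>\<close>. Since \<open>0 powr \<mu> = 0\<close>, it is zero at \<open>\<plusminus>1\<close> for every \<open>\<mu>\<close>.
\<close>
definition gegen_weight :: "complex \<Rightarrow> real \<Rightarrow> complex" where
  "gegen_weight \<mu> x = of_real (1 - x\<^sup>2) powr \<mu>"

lemma gegen_weight_at_ends [simp]: "gegen_weight \<mu> 1 = 0" "gegen_weight \<mu> (- 1) = 0"
  by (simp_all add: gegen_weight_def)

lemma one_minus_sq_pos: "x \<in> {-1<..<1} \<Longrightarrow> 1 - x\<^sup>2 > (0 :: real)"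
  using abs_square_less_1[of x] by (auto simp: abs_less_iff)

lemma gegen_weight_plus1:
  assumes "x \<in> {-1..1}"
  shows "gegen_weight (\<mu> + 1) x = of_real (1 - x\<^sup>2) * gegen_weight \<mu> x"
  by (simp add: gegen_weight_def powr_add mult.commute powr_to_1)

lemma has_vector_derivative_gegen_weight:
  assumes "x \<in> {-1<..<1}"
  shows "(gegen_weight \<mu> has_vector_derivative - 2 * of_real x * \<mu> * gegen_weight (\<mu> - 1) x) (at x)"
proof -
  have "((\<lambda>x. complex_of_real (1 - x\<^sup>2)) has_vector_derivative of_real (- 2 * x)) (at x)"
    by (rule has_vector_derivative_of_real) (auto intro!: derivative_eq_intros simp flip: has_real_derivative_iff_has_vector_derivative)
  moreover have "complex_of_real (1 - x\<^sup>2) \<notin> \<real>\<^sub>\<le>\<^sub>0"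
    using one_minus_sq_pos[OF assms] by (subst complex_nonpos_Reals_iff) auto
  ultimately have "(((\<lambda>z. z powr \<mu>) \<circ> (\<lambda>x. complex_of_real (1 - x\<^sup>2))) has_vector_derivative
     of_real (- 2 * x) * (\<mu> * complex_of_real (1 - x\<^sup>2) powr (\<mu> - 1))) (at x)"
    by (intro field_vector_diff_chain_at has_field_derivative_powr)
  thus ?thesis by (simp add: o_def gegen_weight_def[abs_def] mult_ac)
qed

text \<open>
  The support of \<open>g\<close> is contained in a compact subset of \<open>(-1, 1)\<close>.
\<close>
definition vanishes_near_ends :: "(real \<Rightarrow> complex) \<Rightarrow> bool" where
  "vanishes_near_ends g \<longleftrightarrow> (\<exists>a<1. \<forall>x. a \<le> \<bar>x\<bar> \<longrightarrow> g x = 0)"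

lemma vanishes_near_ends_mult:
  "vanishes_near_ends g \<Longrightarrow> vanishes_near_ends (\<lambda>x. g x * f x)"
  "vanishes_near_ends g \<Longrightarrow> vanishes_near_ends (\<lambda>x. f x * g x)"
  by (auto simp: vanishes_near_ends_def)

lemma vanishes_near_ends_diff:
  assumes "vanishes_near_ends f" "vanishes_near_ends g"
  shows "vanishes_near_ends (\<lambda>x. f x - g x)"
proof -
  obtain a b where "a < 1" "\<forall>x. a \<le> \<bar>x\<bar> \<longrightarrow> f x = 0" "b < 1" "\<forall>x. b \<le> \<bar>x\<bar> \<longrightarrow> g x = 0"
    using assms unfolding vanishes_near_ends_def by blast
  thus ?thesis unfolding vanishes_near_ends_def by (intro exI[of _ "max a b"]) auto
qed

lemma vanishes_near_ends_vderiv: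
  assumes "vanishes_near_ends g"
  shows "vanishes_near_ends (vderiv g)"
proof -
  obtain a where a: "a < 1" "\<And>x. a \<le> \<bar>x\<bar> \<Longrightarrow> g x = 0"
    using assms unfolding vanishes_near_ends_def by blast
  have "vderiv g x = 0" if x: "(a + 1) / 2 \<le> \<bar>x\<bar>" for x
  proof -
    have "open {t. a < \<bar>t\<bar>}" by (intro open_Collect_less continuous_intros)
    moreover have "x \<in> {t. a < \<bar>t\<bar>}" using x a(1) by auto
    ultimately have "(g has_vector_derivative 0) (at x)"
      by (rule has_vector_derivative_transform_within_open[OF has_vector_derivative_const]) (use a in auto)
    thus ?thesis by (simp add: vderiv_def vector_derivative_at)
  qed
  thus ?thesis unfolding vanishes_near_ends_def using a(1) by (intro exI[of _ "(a + 1) / 2"]) auto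
qed

lemma smooth_gegen_weight_mult:
  assumes "smooth f" "vanishes_near_ends f"
  shows "smooth (\<lambda>x. gegen_weight s x * f x)"
  unfolding smooth_iff
proof
  fix k
  show "times_differentiable k (\<lambda>x. gegen_weight s x * f x)" using assms
  proof (induction k arbitrary: s f)
    case (Suc k)
    define f1 where "f1 x = of_real x * (- 2 * s) * f x" for x
    have sm: "smooth f1" unfolding f1_def by (intro smooth_intros Suc.prems)
    have va: "vanishes_near_ends f1" unfolding f1_def by (intro vanishes_near_ends_mult Suc.prems)
    define F where "F x = gegen_weight s x * vderiv f x + gegen_weight (s - 1) x * f1 x" for x
    have "times_differentiable k F" unfolding F_def
      by (intro times_differentiable_add Suc.IH sm va smooth_vderiv vanishes_near_ends_vderiv Suc.prems)
    moreover have "((\<lambda>x. gegen_weight s x * f x) has_vector_derivative F x) (at x)" for x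
    proof (cases "x \<in> {-1<..<1}")
      case True
      have "((\<lambda>x. gegen_weight s x * f x) has_vector_derivative gegen_weight s x * vderiv f x +
          (- 2 * of_real x * s * gegen_weight (s - 1) x) * f x) (at x)"
        by (intro has_vector_derivative_mult smooth_vderiv Suc.prems has_vector_derivative_gegen_weight True)
      thus ?thesis by (simp add: F_def f1_def mult_ac)
    next
      case False
      obtain a where a: "a < 1" "\<And>x. a \<le> \<bar>x\<bar> \<Longrightarrow> f x = 0"
        using Suc.prems(2) unfolding vanishes_near_ends_def by blast
      obtain b where b: "b < 1" "\<And>x. b \<le> \<bar>x\<bar> \<Longrightarrow> vderiv f x = 0"
        using vanishes_near_ends_vderiv[OF Suc.prems(2)] unfolding vanishes_near_ends_def by blast
      have "\<bar>x\<bar> \<ge> 1" using False by auto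
      hence F: "F x = 0" using a b by (simp add: F_def f1_def)
      have "open {t. a < \<bar>t\<bar>}" by (intro open_Collect_less continuous_intros)
      moreover have "x \<in> {t. a < \<bar>t\<bar>}" using \<open>\<bar>x\<bar> \<ge> 1\<close> a(1) by auto
      ultimately show ?thesis unfolding F
        by (rule has_vector_derivative_transform_within_open[OF has_vector_derivative_const]) (use a in auto)
    qed
    ultimately show ?case by auto
  qed auto
qed

lemma test_functions_vanish:
  assumes "f \<in> test_functions {-1<..<1}"
  shows "smooth f" "vanishes_near_ends f"
proof -
  define K where "K = closure {x. f x \<noteq> 0}"
  from assms have K: "smooth f" "compact K" "K \<subseteq> {-1<..<1}" by (auto simp: test_functions_def K_def)
  show "smooth f" by fact
  have out: "f x = 0" if "x \<notin> K" for x
    using that closure_subset[of "{x. f x \<noteq> 0}"] by (auto simp: K_def)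
  show "vanishes_near_ends f"
  proof (cases "K = {}")
    case True
    thus ?thesis using out by (auto simp: vanishes_near_ends_def intro!: exI[of _ 0])
  next
    case False
    have "continuous_on K abs" by (intro continuous_intros)
    then obtain m where m: "m \<in> K" "\<And>x. x \<in> K \<Longrightarrow> \<bar>x\<bar> \<le> \<bar>m\<bar>"
      using continuous_attains_sup[OF K(2) False] by blast
    have "m \<in> {-1<..<1}" using m(1) K(3) by blast
    hence m1: "\<bar>m\<bar> < 1" by (auto simp: abs_less_iff)
    have "f x = 0" if "(\<bar>m\<bar> + 1) / 2 \<le> \<bar>x\<bar>" for x
      using m(2)[of x] m1 that by (intro out) auto
    thus ?thesis unfolding vanishes_near_ends_def using m1 by (intro exI[of _ "(\<bar>m\<bar> + 1) / 2"]) auto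
  qed
qed

text \<open>
  The smooth functions that can be integrated against \<open>(1 - x\<^sup>2)\<^sup>\<mu>\<close>, by parts and without boundary terms:
  either the weight is continuous and zero at the ends, or the function is supported away from them.
  \<open>Re \<mu> > 0\<close> would suffice for this; the bound \<open>1\<close> simplifies the analytic continuation of the Beta
  integral.
\<close>
definition admissible :: "complex \<Rightarrow> (real \<Rightarrow> complex) \<Rightarrow> bool" where
  "admissible \<mu> g \<longleftrightarrow> smooth g \<and> (Re \<mu> > 1 \<or> vanishes_near_ends g)"

lemma admissible_smooth: "admissible \<mu> g \<Longrightarrow> smooth g"
  by (simp add: admissible_def)

lemma admissible_mult:
  "admissible \<mu> g \<Longrightarrow> smooth f \<Longrightarrow> admissible \<mu> (\<lambda>x. g x * f x)"
  "admissible \<mu> g \<Longrightarrow> smooth f \<Longrightarrow> admissible \<mu> (\<lambda>x. f x * g x)"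
  by (auto simp: admissible_def intro: smooth_mult vanishes_near_ends_mult)

lemma admissible_diff:
  "admissible \<mu> f \<Longrightarrow> admissible \<mu> g \<Longrightarrow> admissible \<mu> (\<lambda>x. f x - g x)"
  by (auto simp: admissible_def intro: smooth_diff vanishes_near_ends_diff)

lemma admissible_vderiv: "admissible \<mu> g \<Longrightarrow> admissible \<mu> (vderiv g)"
  by (auto simp: admissible_def intro: smooth_vderiv vanishes_near_ends_vderiv)

lemma admissible_plus1: "admissible \<mu> g \<Longrightarrow> admissible (\<mu> + 1) g"
  by (auto simp: admissible_def)

lemma continuous_on_gegen_weight_mult:
  assumes "admissible \<mu> g"
  shows "continuous_on {-1..1} (\<lambda>x. gegen_weight \<mu> x * g x)"
proof (cases "vanishes_near_ends g")
  case True
  thus ?thesis using assms by (intro continuous_on_smooth smooth_gegen_weight_mult) (auto simp: admissible_def)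
next
  case False
  hence re: "Re \<mu> > 1" using assms by (auto simp: admissible_def)
  have "x\<^sup>2 \<le> 1" if "x \<in> {-1..1}" for x :: real
    using that by (simp add: abs_square_le_1 abs_le_iff)
  hence "continuous_on {-1..1} (gegen_weight \<mu>)"
    unfolding gegen_weight_def using re by (intro continuous_intros) auto
  thus ?thesis by (rule continuous_on_mult[OF _ continuous_on_smooth[OF admissible_smooth[OF assms]]])
qed

text \<open>
  The integrand is the derivative of \<open>(1 - x\<^sup>2)\<^sup>\<mu>\<^sup>+\<^sup>1 \<phi>(x)\<close>, which is zero at both ends. All
  integrations by parts below are instances of this lemma.
\<close>
lemma weighted_integral_of_divergence:
  assumes "admissible \<mu> \<phi>"
  shows "((\<lambda>x. gegen_weight \<mu> x * (of_real (1 - x\<^sup>2) * vderiv \<phi> x - 2 * (\<mu> + 1) * of_real x * \<phi> x)) has_integral 0) {-1..1}"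
proof -
  define F where "F x = gegen_weight (\<mu> + 1) x * \<phi> x" for x
  have "((\<lambda>x. gegen_weight \<mu> x * (of_real (1 - x\<^sup>2) * vderiv \<phi> x - 2 * (\<mu> + 1) * of_real x * \<phi> x)) has_integral F 1 - F (-1)) {-1..1}"
  proof (rule fundamental_theorem_of_calculus_interior)
    show "continuous_on {-1..1} F"
      unfolding F_def by (intro continuous_on_gegen_weight_mult admissible_plus1 assms)
    fix x :: real assume x: "x \<in> {-1<..<1}"
    have "(F has_vector_derivative gegen_weight (\<mu> + 1) x * vderiv \<phi> x +
       (- 2 * of_real x * (\<mu> + 1) * gegen_weight (\<mu> + 1 - 1) x) * \<phi> x) (at x)"
      unfolding F_def using admissible_smooth[OF assms]
      by (intro has_vector_derivative_mult smooth_vderiv has_vector_derivative_gegen_weight x)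
    moreover have "gegen_weight (\<mu> + 1) x * vderiv \<phi> x + (- 2 * of_real x * (\<mu> + 1) * gegen_weight (\<mu> + 1 - 1) x) * \<phi> x
      = gegen_weight \<mu> x * (of_real (1 - x\<^sup>2) * vderiv \<phi> x - 2 * (\<mu> + 1) * of_real x * \<phi> x)"
    proof -
      have "x \<in> {-1..1}" using x by auto
      thus ?thesis unfolding gegen_weight_plus1[OF \<open>x \<in> {-1..1}\<close>] by (simp add: algebra_simps)
    qed
    ultimately show "(F has_vector_derivative gegen_weight \<mu> x * (of_real (1 - x\<^sup>2) * vderiv \<phi> x - 2 * (\<mu> + 1) * of_real x * \<phi> x)) (at x)"
      by metis
  qed auto
  thus ?thesis by (simp add: F_def)
qed

section \<open>Rapid decay of the Gegenbauer coefficients\<close>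

text \<open>
  The unnormalised Gegenbauer coefficient \<open>\<integral> g p\<^sub>n (1 - x\<^sup>2)\<^sup>\<mu> dx\<close> of \<open>g\<close>.
\<close>
definition gegen_pairing :: "complex \<Rightarrow> nat \<Rightarrow> (real \<Rightarrow> complex) \<Rightarrow> complex" where
  "gegen_pairing \<mu> n g = integral {-1..1} (\<lambda>x. gegen_weight \<mu> x * (g x * gegen \<mu> n x))"

lemma has_integral_gegen_pairing:
  assumes "admissible \<mu> g"
  shows "((\<lambda>x. gegen_weight \<mu> x * (g x * gegen \<mu> n x)) has_integral gegen_pairing \<mu> n g) {-1..1}"
  unfolding gegen_pairing_def
  by (intro integrable_integral integrable_continuous_real continuous_on_gegen_weight_mult admissible_mult assms smooth_gegen)

text \<open>
  The Gegenbauer operator, of which \<open>p\<^sub>n\<close> is an eigenfunction with eigenvalue \<open>-n (n + 2\<mu> + 1)\<close>.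
\<close>
definition gegen_op :: "complex \<Rightarrow> (real \<Rightarrow> complex) \<Rightarrow> real \<Rightarrow> complex" where
  "gegen_op \<mu> g x = of_real (1 - x\<^sup>2) * vderiv (vderiv g) x - 2 * (\<mu> + 1) * of_real x * vderiv g x"

lemma admissible_gegen_op:
  "admissible \<mu> g \<Longrightarrow> admissible \<mu> (gegen_op \<mu> g)"
  unfolding gegen_op_def[abs_def]
  by (intro admissible_diff admissible_mult smooth_intros admissible_vderiv)

lemma gegen_pairing_op:
  assumes reg: "2 * \<mu> + 1 \<notin> \<int>\<^sub>\<le>\<^sub>0" and g: "admissible \<mu> g"
  shows "gegen_pairing \<mu> n (gegen_op \<mu> g) = - (of_nat n * (of_nat n + 2 * \<mu> + 1)) * gegen_pairing \<mu> n g"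
proof -
  define e where "e = of_nat n * (of_nat n + 2 * \<mu> + 1)"
  \<comment> \<open>The Wronskian of \<open>g\<close> and \<open>p\<^sub>n\<close>, as in Green's formula.\<close>
  define \<phi> where "\<phi> x = vderiv g x * gegen \<mu> n x - g x * gegen_deriv \<mu> n x" for x
  have sg: "smooth g" using g by (rule admissible_smooth)
  have "admissible \<mu> \<phi>" unfolding \<phi>_def
    by (intro admissible_diff admissible_mult admissible_vderiv g smooth_gegen smooth_gegen_deriv)
  note stokes = weighted_integral_of_divergence[OF this]
  have D: "vderiv \<phi> x = vderiv (vderiv g) x * gegen \<mu> n x - g x * gegen_deriv2 \<mu> n x" for x
  proof -
    have "(\<phi> has_vector_derivative (vderiv g x * gegen_deriv \<mu> n x + vderiv (vderiv g) x * gegen \<mu> n x) -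
       (g x * gegen_deriv2 \<mu> n x + vderiv g x * gegen_deriv \<mu> n x)) (at x)"
      unfolding \<phi>_def
      by (intro has_vector_derivative_diff has_vector_derivative_mult has_vector_derivative_gegen
            has_vector_derivative_gegen_deriv smooth_vderiv sg)
    thus ?thesis unfolding vderiv_def[of \<phi>] by (simp add: vector_derivative_at)
  qed
  have "of_real (1 - x\<^sup>2) * vderiv \<phi> x - 2 * (\<mu> + 1) * of_real x * \<phi> x
      = gegen_op \<mu> g x * gegen \<mu> n x + e * (g x * gegen \<mu> n x)" for x
    using gegen_ode[OF reg, of x n, folded e_def] unfolding D \<phi>_def gegen_op_def by algebra
  with stokes have 1: "((\<lambda>x. gegen_weight \<mu> x * (gegen_op \<mu> g x * gegen \<mu> n x + e * (g x * gegen \<mu> n x))) has_integral 0) {-1..1}"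
    by simp
  have "((\<lambda>x. gegen_weight \<mu> x * (gegen_op \<mu> g x * gegen \<mu> n x) + e * (gegen_weight \<mu> x * (g x * gegen \<mu> n x)))
      has_integral gegen_pairing \<mu> n (gegen_op \<mu> g) + e * gegen_pairing \<mu> n g) {-1..1}"
    by (intro has_integral_add has_integral_mult_right has_integral_gegen_pairing g admissible_gegen_op)
  hence 2: "((\<lambda>x. gegen_weight \<mu> x * (gegen_op \<mu> g x * gegen \<mu> n x + e * (g x * gegen \<mu> n x)))
      has_integral gegen_pairing \<mu> n (gegen_op \<mu> g) + e * gegen_pairing \<mu> n g) {-1..1}"
    by (simp add: algebra_simps)
  from has_integral_unique[OF 1 2] show ?thesis by (simp add: e_def add_eq_0_iff)
qed

text \<open>
  The derivative of \<open>p\<^sub>n\<^sub>+\<^sub>1\<close> is a multiple of the \<open>n\<close>-th polynomial for \<open>\<mu> + 1\<close>. An integration by parts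
  turns this into a relation between the coefficients of \<open>g\<close> for \<open>\<mu>\<close> and those of \<open>g'\<close> for \<open>\<mu> + 1\<close>.
\<close>
lemma gegen_pairing_shift:
  assumes reg: "2 * \<mu> + 1 \<notin> \<int>\<^sub>\<le>\<^sub>0" and g: "admissible \<mu> g"
  shows "gegen_pairing (\<mu> + 1) n (vderiv g) = 2 * (\<mu> + 1) * gegen_pairing \<mu> (Suc n) g"
proof -
  define e where "e = of_nat (Suc n) * (of_nat (Suc n) + 2 * \<mu> + 1)"
  have nz: "e \<noteq> 0" "\<mu> + 1 \<noteq> 0"
  proof -
    have "of_nat (Suc n) + 2 * \<mu> + 1 = 2 * \<mu> + 1 + of_nat (Suc n)" by (simp only: add_ac)
    thus "e \<noteq> 0" using gegen_order_regular(2)[OF reg, of "Suc n"] of_nat_neq_0[of n, where 'a = complex]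
      unfolding e_def by (metis mult_eq_0_iff)
    show "\<mu> + 1 \<noteq> 0" by (rule gegen_order_regular(4)[OF reg])
  qed
  define k where "k = e / (2 * (\<mu> + 1))"
  have gd: "gegen_deriv \<mu> (Suc n) x = k * gegen (\<mu> + 1) n x" for x
    unfolding gegen_deriv_eq[OF reg] k_def e_def diff_Suc_1 ..
  define \<phi> where "\<phi> x = g x * gegen_deriv \<mu> (Suc n) x" for x
  have sg: "smooth g" using g by (rule admissible_smooth)
  have "admissible \<mu> \<phi>" unfolding \<phi>_def by (intro admissible_mult g smooth_gegen_deriv)
  note stokes = weighted_integral_of_divergence[OF this]
  have D: "vderiv \<phi> x = g x * gegen_deriv2 \<mu> (Suc n) x + vderiv g x * gegen_deriv \<mu> (Suc n) x" for x
    unfolding vderiv_def[of \<phi>] \<phi>_def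
    by (intro vector_derivative_at has_vector_derivative_mult has_vector_derivative_gegen_deriv smooth_vderiv sg)
  have "of_real (1 - x\<^sup>2) * vderiv \<phi> x - 2 * (\<mu> + 1) * of_real x * \<phi> x
      = of_real (1 - x\<^sup>2) * (vderiv g x * gegen_deriv \<mu> (Suc n) x) - e * (g x * gegen \<mu> (Suc n) x)" for x
    using gegen_ode[OF reg, of x "Suc n", folded e_def] unfolding D \<phi>_def by algebra
  with stokes have "((\<lambda>x. gegen_weight \<mu> x * (of_real (1 - x\<^sup>2) * (vderiv g x * gegen_deriv \<mu> (Suc n) x) - e * (g x * gegen \<mu> (Suc n) x))) has_integral 0) {-1..1}"
    by simp
  hence 1: "((\<lambda>x. k * (gegen_weight (\<mu> + 1) x * (vderiv g x * gegen (\<mu> + 1) n x)) - e * (gegen_weight \<mu> x * (g x * gegen \<mu> (Suc n) x))) has_integral 0) {-1..1}"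
  proof (rule has_integral_eq[rotated])
    fix x :: real assume "x \<in> {-1..1}"
    show "gegen_weight \<mu> x * (of_real (1 - x\<^sup>2) * (vderiv g x * gegen_deriv \<mu> (Suc n) x) - e * (g x * gegen \<mu> (Suc n) x))
       = k * (gegen_weight (\<mu> + 1) x * (vderiv g x * gegen (\<mu> + 1) n x)) - e * (gegen_weight \<mu> x * (g x * gegen \<mu> (Suc n) x))"
      unfolding gegen_weight_plus1[OF \<open>x \<in> {-1..1}\<close>] gd
      by (simp add: algebra_simps)
  qed
  have 2: "((\<lambda>x. k * (gegen_weight (\<mu> + 1) x * (vderiv g x * gegen (\<mu> + 1) n x)) - e * (gegen_weight \<mu> x * (g x * gegen \<mu> (Suc n) x)))
      has_integral k * gegen_pairing (\<mu> + 1) n (vderiv g) - e * gegen_pairing \<mu> (Suc n) g) {-1..1}"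
    by (intro has_integral_diff has_integral_mult_right has_integral_gegen_pairing g admissible_plus1 admissible_vderiv)
  from has_integral_unique[OF 1 2]
  have "e * (gegen_pairing (\<mu> + 1) n (vderiv g) / (2 * (\<mu> + 1))) = e * gegen_pairing \<mu> (Suc n) g" by (simp add: k_def)
  hence "gegen_pairing (\<mu> + 1) n (vderiv g) / (2 * (\<mu> + 1)) = gegen_pairing \<mu> (Suc n) g"
    using nz(1) by (metis mult_left_cancel)
  thus ?thesis using nz(2) by (metis nonzero_eq_divide_eq mult.commute mult_eq_0_iff zero_neq_numeral)
qed

text \<open>
  The coefficients decay faster than any power of \<open>n\<close>: each application of the Gegenbauer operator
  gains a factor of order \<open>n\<^sup>-\<^sup>2\<close> over the crude bound by a fixed power \<open>n\<^sup>A\<close>.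
\<close>
lemma gegen_pairing_decay:
  assumes reg: "2 * \<mu> + 1 \<notin> \<int>\<^sub>\<le>\<^sub>0" and g: "admissible \<mu> g"
  obtains C where "C \<ge> 0" "\<And>n. norm (gegen_pairing \<mu> n g) \<le> C / real (n + 1) ^ r"
proof -
  obtain A where A: "\<And>n x. x \<in> {-1..1} \<Longrightarrow> norm (gegen \<mu> n x) \<le> real (n + 1) ^ A"
    using gegen_growth[OF reg] by blast
  obtain \<delta> where \<delta>: "\<delta> > 0" "\<And>n. \<delta> * real (n + 1) \<le> norm (2 * \<mu> + 1 + of_nat n)"
    using norm_add_of_nat_lower[OF reg] by blast
  have crude: "\<exists>C\<ge>0. \<forall>n. norm (gegen_pairing \<mu> n g) \<le> C * real (n + 1) ^ A" if g: "admissible \<mu> g" for g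
  proof -
    have "compact ((\<lambda>x. gegen_weight \<mu> x * g x) ` {-1..1})"
      by (intro compact_continuous_image continuous_on_gegen_weight_mult g compact_Icc)
    then obtain B where B: "B > 0" "\<And>x. x \<in> {-1..1} \<Longrightarrow> norm (gegen_weight \<mu> x * g x) \<le> B"
      using compact_imp_bounded bounded_pos by (metis (no_types, lifting) imageI)
    have "norm (gegen_pairing \<mu> n g) \<le> (2 * B) * real (n + 1) ^ A" for n
    proof -
      have "norm (gegen_pairing \<mu> n g) \<le> (B * real (n + 1) ^ A) * measure lborel {-1..1::real}"
      proof (rule has_integral_bound_real[OF _ _ has_integral_gegen_pairing[OF g], where S = "{}"])
        show "0 \<le> B * real (n + 1) ^ A" using B by simp
        show "norm (gegen_weight \<mu> x * (g x * gegen \<mu> n x)) \<le> B * real (n + 1) ^ A" if "x \<in> {-1..1} - {}" for x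
          unfolding mult.assoc[symmetric] norm_mult[of _ "gegen \<mu> n x"]
          by (intro mult_mono A B) (use B that in auto)
      qed simp
      thus ?thesis by simp
    qed
    thus ?thesis using B(1) by (intro exI[of _ "2 * B"]) auto
  qed
  have decay: "\<exists>C\<ge>0. \<forall>n\<ge>1. norm (gegen_pairing \<mu> n g) * real (n + 1) ^ (2 * m) \<le> C * real (n + 1) ^ A"
    if g: "admissible \<mu> g" for g m
    using g
  proof (induction m arbitrary: g)
    case 0
    thus ?case using crude[OF 0] by auto
  next
    case (Suc m)
    obtain C where C: "C \<ge> 0" "\<And>n. n \<ge> 1 \<Longrightarrow> norm (gegen_pairing \<mu> n (gegen_op \<mu> g)) * real (n + 1) ^ (2 * m) \<le> C * real (n + 1) ^ A"
      using Suc.IH[OF admissible_gegen_op[OF Suc.prems]] by blast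
    have "norm (gegen_pairing \<mu> n g) * real (n + 1) ^ (2 * Suc m) \<le> (2 / \<delta> * C) * real (n + 1) ^ A" if n: "n \<ge> 1" for n
    proof -
      have "real (n + 1) * (\<delta> * real (n + 1)) \<le> (2 * real n) * norm (2 * \<mu> + 1 + of_nat n)"
        using \<delta> n by (intro mult_mono) auto
      hence "real (n + 1) ^ 2 \<le> 2 / \<delta> * (real n * norm (2 * \<mu> + 1 + of_nat n))"
        using \<delta>(1) by (simp add: field_simps power2_eq_square)
      hence "norm (gegen_pairing \<mu> n g) * real (n + 1) ^ 2 \<le> norm (gegen_pairing \<mu> n g) * (2 / \<delta> * (real n * norm (2 * \<mu> + 1 + of_nat n)))"
        by (intro mult_left_mono) auto
      also have "\<dots> = 2 / \<delta> * norm (gegen_pairing \<mu> n (gegen_op \<mu> g))"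
        unfolding gegen_pairing_op[OF reg Suc.prems] by (simp add: norm_mult add_ac)
      finally have "norm (gegen_pairing \<mu> n g) * real (n + 1) ^ 2 * real (n + 1) ^ (2 * m) \<le>
         2 / \<delta> * norm (gegen_pairing \<mu> n (gegen_op \<mu> g)) * real (n + 1) ^ (2 * m)"
        by (intro mult_right_mono) auto
      also have "\<dots> = 2 / \<delta> * (norm (gegen_pairing \<mu> n (gegen_op \<mu> g)) * real (n + 1) ^ (2 * m))" by simp
      also have "\<dots> \<le> 2 / \<delta> * (C * real (n + 1) ^ A)"
        using \<delta>(1) by (intro mult_left_mono C n) auto
      finally show ?thesis by (simp add: power_add[symmetric] mult.assoc)
    qed
    thus ?case using C(1) \<delta>(1) by (intro exI[of _ "2 / \<delta> * C"]) auto
  qed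
  obtain C where C: "C \<ge> 0" "\<And>n. n \<ge> 1 \<Longrightarrow> norm (gegen_pairing \<mu> n g) * real (n + 1) ^ (2 * (A + r)) \<le> C * real (n + 1) ^ A"
    using decay[OF g, of "A + r"] by blast
  have "norm (gegen_pairing \<mu> n g) \<le> max C (norm (gegen_pairing \<mu> 0 g)) / real (n + 1) ^ r" for n
  proof (cases "n = 0")
    case False
    define N where "N = real (n + 1)"
    have N: "N \<ge> 1" by (simp add: N_def)
    have "norm (gegen_pairing \<mu> n g) * N ^ r * N ^ A \<le> norm (gegen_pairing \<mu> n g) * N ^ (2 * (A + r))"
      unfolding mult.assoc power_add[symmetric] using N by (intro mult_left_mono power_increasing) auto
    also have "\<dots> \<le> C * N ^ A" using C(2)[of n] False by (simp add: N_def)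
    finally have "norm (gegen_pairing \<mu> n g) * N ^ r \<le> C" using N by simp
    also have "C \<le> max C (norm (gegen_pairing \<mu> 0 g))" by simp
    finally show ?thesis using N by (simp add: field_simps N_def)
  qed auto
  thus ?thesis using C(1) by (intro that[of "max C (norm (gegen_pairing \<mu> 0 g))"]) auto
qed

section \<open>The Christoffel-Darboux formula and zeros of the expanded function\<close>

text \<open>
  The Christoffel-Darboux formula in an abstract form: \<open>u\<close> is the sequence \<open>p\<^sub>n(y)\<close>, while \<open>v\<close> and \<open>v'\<close> are
  the values of a linear functional at \<open>p\<^sub>n\<close> and at \<open>x p\<^sub>n\<close>.
\<close>
lemma christoffel_darboux:
  fixes u v v' :: "nat \<Rightarrow> complex" and y c :: complex
  assumes u1: "u 1 = y * u 0" and v1: "v 1 = v' 0"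
    and u: "\<And>n. (of_nat (Suc n) + c) * u (Suc (Suc n)) + of_nat (Suc n) * u n = (2 * of_nat (Suc n) + c) * y * u (Suc n)"
    and v: "\<And>n. (of_nat (Suc n) + c) * v (Suc (Suc n)) + of_nat (Suc n) * v n = (2 * of_nat (Suc n) + c) * v' (Suc n)"
  shows "(\<Sum>n\<le>N. (of_nat n + c / 2) * pochhammer c n / fact n * (u n * (v' n - y * v n))) =
           pochhammer c (Suc N) / (2 * fact N) * (u N * v (Suc N) - u (Suc N) * v N)"
proof (induction N)
  case 0
  show ?case using u1 v1 by (simp add: algebra_simps)
next
  case (Suc N)
  define M :: complex where "M = of_nat (Suc N)"
  define P where "P = pochhammer c (Suc N) / fact N"
  have M: "M \<noteq> 0" by (simp add: M_def del: of_nat_Suc)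
  define Q where "Q = pochhammer c (Suc N) / fact (Suc N)"
  have Q: "Q = P / M"
    unfolding Q_def fact_Suc[of N] P_def M_def by (simp del: of_nat_Suc)
  have "pochhammer c (Suc (Suc N)) / (2 * fact (Suc N)) = Q * (c + M) / 2"
    unfolding pochhammer_Suc[of c "Suc N"] Q_def M_def by (simp del: of_nat_Suc fact_Suc)
  hence e2: "pochhammer c (Suc (Suc N)) / (2 * fact (Suc N)) = P / M * (c + M) / 2"
    by (simp only: Q)
  have e3: "pochhammer c (Suc N) / (2 * fact N) = P / 2" by (simp add: P_def)
  have e4: "(M + c / 2) * pochhammer c (Suc N) / fact (Suc N) = (M + c / 2) * (P / M)"
    unfolding Q[symmetric] Q_def by (simp only: times_divide_eq_right)
  have "(\<Sum>n\<le>Suc N. (of_nat n + c / 2) * pochhammer c n / fact n * (u n * (v' n - y * v n))) =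
     P / 2 * (u N * v (Suc N) - u (Suc N) * v N) + (M + c / 2) * (P / M) * (u (Suc N) * (v' (Suc N) - y * v (Suc N)))"
    unfolding sum.atMost_Suc Suc.IH e3 M_def[symmetric] e4 ..
  also have "\<dots> = P / M / 2 * (M * (u N * v (Suc N) - u (Suc N) * v N) + u (Suc N) * ((2 * M + c) * v' (Suc N)) - v (Suc N) * ((2 * M + c) * y * u (Suc N)))"
    using M by (simp add: field_simps)
  also have "\<dots> = P / M / 2 * ((c + M) * (u (Suc N) * v (Suc (Suc N)) - u (Suc (Suc N)) * v (Suc N)))"
    unfolding M_def u[symmetric] v[symmetric] by (simp add: algebra_simps)
  finally show ?case unfolding e2 by (simp add: mult_ac)
qed

lemma gegen_pairing_times_x:
  assumes reg: "2 * \<mu> + 1 \<notin> \<int>\<^sub>\<le>\<^sub>0" and g: "admissible \<mu> g"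
  shows "(of_nat (Suc n) + (2 * \<mu> + 1)) * gegen_pairing \<mu> (Suc (Suc n)) g + of_nat (Suc n) * gegen_pairing \<mu> n g
     = (2 * of_nat (Suc n) + (2 * \<mu> + 1)) * gegen_pairing \<mu> (Suc n) (\<lambda>x. of_real x * g x)"
proof -
  define a b d :: complex where "a = of_nat (Suc n) + 2 * \<mu> + 1" and "b = of_nat (Suc n)" and "d = 2 * of_nat (Suc n) + 2 * \<mu> + 1"
  have 1: "((\<lambda>x. a * (gegen_weight \<mu> x * (g x * gegen \<mu> (Suc (Suc n)) x)) + b * (gegen_weight \<mu> x * (g x * gegen \<mu> n x)))
     has_integral a * gegen_pairing \<mu> (Suc (Suc n)) g + b * gegen_pairing \<mu> n g) {-1..1}"
    by (intro has_integral_add has_integral_mult_right has_integral_gegen_pairing g)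
  have 2: "((\<lambda>x. d * (gegen_weight \<mu> x * ((of_real x * g x) * gegen \<mu> (Suc n) x)))
     has_integral d * gegen_pairing \<mu> (Suc n) (\<lambda>x. of_real x * g x)) {-1..1}"
    by (intro has_integral_mult_right has_integral_gegen_pairing admissible_mult g smooth_of_real)
  have "(\<lambda>x. a * (gegen_weight \<mu> x * (g x * gegen \<mu> (Suc (Suc n)) x)) + b * (gegen_weight \<mu> x * (g x * gegen \<mu> n x)))
     = (\<lambda>x. d * (gegen_weight \<mu> x * ((of_real x * g x) * gegen \<mu> (Suc n) x)))"
  proof
    fix x
    show "a * (gegen_weight \<mu> x * (g x * gegen \<mu> (Suc (Suc n)) x)) + b * (gegen_weight \<mu> x * (g x * gegen \<mu> n x))
      = d * (gegen_weight \<mu> x * ((of_real x * g x) * gegen \<mu> (Suc n) x))"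
      using gegen_rec[OF reg, of n x, folded a_def b_def d_def] by algebra
  qed
  from 1[unfolded this] 2 have "a * gegen_pairing \<mu> (Suc (Suc n)) g + b * gegen_pairing \<mu> n g = d * gegen_pairing \<mu> (Suc n) (\<lambda>x. of_real x * g x)"
    by (rule has_integral_unique)
  thus ?thesis by (simp only: a_def b_def d_def add.assoc)
qed

text \<open>
  The weight of the \<open>n\<close>-th term of the expansion, up to the factor \<open>gegen_total\<close> below, which does
  not depend on \<open>n\<close>.
\<close>
definition gegen_norm :: "complex \<Rightarrow> nat \<Rightarrow> complex" where
  "gegen_norm \<mu> n = (of_nat n + (2 * \<mu> + 1) / 2) * pochhammer (2 * \<mu> + 1) n / fact n"

text \<open>
  The \<open>n\<close>-th term of the Gegenbauer expansion of \<open>h\<close> at the point \<open>x\<close>.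
\<close>
definition gegen_term :: "complex \<Rightarrow> (real \<Rightarrow> complex) \<Rightarrow> nat \<Rightarrow> real \<Rightarrow> complex" where
  "gegen_term \<mu> h n x = gegen_norm \<mu> n * (gegen \<mu> n x * gegen_pairing \<mu> n h)"

lemma gegen_pairing_diff:
  assumes "admissible \<mu> f" "admissible \<mu> g"
  shows "gegen_pairing \<mu> n (\<lambda>x. f x - g x) = gegen_pairing \<mu> n f - gegen_pairing \<mu> n g"
proof -
  have "((\<lambda>x. gegen_weight \<mu> x * (f x * gegen \<mu> n x) - gegen_weight \<mu> x * (g x * gegen \<mu> n x))
      has_integral gegen_pairing \<mu> n f - gegen_pairing \<mu> n g) {-1..1}"
    by (intro has_integral_diff has_integral_gegen_pairing assms)
  thus ?thesis unfolding gegen_pairing_def[of _ _ "\<lambda>x. f x - g x"]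
    by (intro integral_unique) (simp add: algebra_simps)
qed

lemma gegen_pairing_cmult: "gegen_pairing \<mu> n (\<lambda>x. c * f x) = c * gegen_pairing \<mu> n f"
  unfolding gegen_pairing_def by (subst integral_mult_right[symmetric]) (simp add: mult_ac)

lemma gegen_norm_growth:
  obtains K m where "K \<ge> 0" "\<And>n. norm (gegen_norm \<mu> n) \<le> K * real (n + 1) ^ m"
proof -
  obtain m where m: "\<And>n. norm (pochhammer (2 * \<mu> + 1) n / fact n) \<le> real (n + 1) ^ m"
    using pochhammer_over_fact_growth by blast
  define q where "q = norm ((2 * \<mu> + 1) / 2)"
  define K where "K = 1 + q"
  have q: "q \<ge> 0" by (simp add: q_def)
  have "norm (gegen_norm \<mu> n) \<le> K * real (n + 1) ^ Suc m" for n
  proof -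
    have "norm (of_nat n + (2 * \<mu> + 1) / 2) \<le> real n + q"
      unfolding q_def by (metis norm_of_nat norm_triangle_ineq)
    also have "\<dots> \<le> K * real (n + 1)"
      using q by (simp add: K_def algebra_simps)
    finally have "norm (of_nat n + (2 * \<mu> + 1) / 2) \<le> K * real (n + 1)" .
    hence "norm (of_nat n + (2 * \<mu> + 1) / 2) * norm (pochhammer (2 * \<mu> + 1) n / fact n) \<le> (K * real (n + 1)) * real (n + 1) ^ m"
      by (intro mult_mono m) (use q in \<open>auto simp: K_def\<close>)
    thus ?thesis by (simp add: gegen_norm_def norm_mult norm_divide mult.assoc)
  qed
  thus ?thesis by (intro that[of K "Suc m"]) (use q in \<open>auto simp: K_def\<close>)
qed

lemma gegen_term_bound:
  assumes reg: "2 * \<mu> + 1 \<notin> \<int>\<^sub>\<le>\<^sub>0" and h: "admissible \<mu> h"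
  obtains C where "\<And>n x. x \<in> {-1..1} \<Longrightarrow> norm (gegen_term \<mu> h n x) \<le> C / real (n + 1) ^ 2"
proof -
  obtain K m where K: "K \<ge> 0" "\<And>n. norm (gegen_norm \<mu> n) \<le> K * real (n + 1) ^ m"
    using gegen_norm_growth by blast
  obtain A where A: "\<And>n x. x \<in> {-1..1} \<Longrightarrow> norm (gegen \<mu> n x) \<le> real (n + 1) ^ A"
    using gegen_growth[OF reg] by blast
  obtain C where C: "C \<ge> 0" "\<And>n. norm (gegen_pairing \<mu> n h) \<le> C / real (n + 1) ^ (m + A + 2)"
    using gegen_pairing_decay[OF reg h] by blast
  have "norm (gegen_term \<mu> h n x) \<le> (K * C) / real (n + 1) ^ 2" if x: "x \<in> {-1..1}" for n x
  proof -
    have "norm (gegen_term \<mu> h n x) \<le> (K * real (n + 1) ^ m) * (real (n + 1) ^ A * (C / real (n + 1) ^ (m + A + 2)))"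
      unfolding gegen_term_def norm_mult by (intro mult_mono K A C x) (use K in auto)
    thus ?thesis by (simp add: power_add power2_eq_square)
  qed
  thus ?thesis using that by blast
qed

text \<open>
  If \<open>h(y) = 0\<close>, then \<open>h(x) = (x - y) g(x)\<close> with \<open>g\<close> of the same kind. By the Christoffel-Darboux formula,
  the partial sums at \<open>y\<close> consist of two terms with coefficients of \<open>g\<close>, and these decay rapidly.
\<close>
lemma sums_gegen_term_at_zero:
  assumes reg: "2 * \<mu> + 1 \<notin> \<int>\<^sub>\<le>\<^sub>0" and h: "admissible \<mu> h" and y: "y \<in> {-1<..<1}" and hy: "h y = 0"
  shows "(\<lambda>n. gegen_term \<mu> h n y) sums 0"
proof -
  obtain g where g: "smooth g" "\<And>x. h x = of_real (x - y) * g x"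
    using hadamard_quotient[OF admissible_smooth[OF h] hy] by blast
  have ag: "admissible \<mu> g"
  proof (cases "Re \<mu> > 1")
    case False
    then obtain a where a: "a < 1" "\<And>x. a \<le> \<bar>x\<bar> \<Longrightarrow> h x = 0"
      using h unfolding admissible_def vanishes_near_ends_def by blast
    \<comment> \<open>The quotient \<open>g = h / (x - y)\<close> inherits the support of \<open>h\<close> once \<open>x\<close> is also kept away from \<open>y\<close>.\<close>
    have "g x = 0" if "max a ((1 + \<bar>y\<bar>) / 2) \<le> \<bar>x\<bar>" for x
      using a(2)[of x] g(2)[of x] that y by (auto simp: max_def split: if_splits)
    thus ?thesis using g(1) a(1) y unfolding admissible_def vanishes_near_ends_def
      by (intro conjI disjI2 exI[of _ "max a ((1 + \<bar>y\<bar>) / 2)"]) auto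
  qed (use g in \<open>auto simp: admissible_def\<close>)
  define v where "v n = gegen_pairing \<mu> n g" for n
  define v' where "v' n = gegen_pairing \<mu> n (\<lambda>x. of_real x * g x)" for n
  define u where "u n = gegen \<mu> n y" for n
  have ph: "gegen_pairing \<mu> n h = v' n - of_real y * v n" for n
  proof -
    have "h = (\<lambda>x. of_real x * g x - of_real y * g x)" using g(2) by (auto simp: algebra_simps)
    hence "gegen_pairing \<mu> n h = v' n - gegen_pairing \<mu> n (\<lambda>x. of_real y * g x)"
      unfolding v'_def by (simp only: gegen_pairing_diff[OF admissible_mult(2)[OF ag smooth_of_real] admissible_mult(2)[OF ag smooth_const]])
    thus ?thesis by (simp add: gegen_pairing_cmult v_def)
  qed
  have v1: "v 1 = v' 0"
    using gegen_1[OF reg] unfolding v_def v'_def gegen_pairing_def by (simp add: mult_ac)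
  have u1: "u 1 = of_real y * u 0" using gegen_1[OF reg] by (simp add: u_def)
  define c where "c = 2 * \<mu> + 1"
  have cd: "(\<Sum>n\<le>N. gegen_term \<mu> h n y) = pochhammer c (Suc N) / (2 * fact N) * (u N * v (Suc N) - u (Suc N) * v N)" for N
  proof -
    have "(\<Sum>n\<le>N. (of_nat n + c / 2) * pochhammer c n / fact n * (u n * (v' n - of_real y * v n))) =
           pochhammer c (Suc N) / (2 * fact N) * (u N * v (Suc N) - u (Suc N) * v N)"
    proof (rule christoffel_darboux[where u = u and v = v and v' = v' and y = "of_real y" and c = c, OF u1 v1])
      fix n
      show "(of_nat (Suc n) + c) * u (Suc (Suc n)) + of_nat (Suc n) * u n = (2 * of_nat (Suc n) + c) * of_real y * u (Suc n)"
        using gegen_rec[OF reg, of n y] unfolding u_def c_def by (simp only: add.assoc)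
      show "(of_nat (Suc n) + c) * v (Suc (Suc n)) + of_nat (Suc n) * v n = (2 * of_nat (Suc n) + c) * v' (Suc n)"
        using gegen_pairing_times_x[OF reg ag, of n] unfolding v_def v'_def c_def .
    qed
    thus ?thesis unfolding gegen_term_def gegen_norm_def ph u_def c_def .
  qed
  obtain m where m: "\<And>n. norm (pochhammer c n / fact n) \<le> real (n + 1) ^ m"
    using pochhammer_over_fact_growth by blast
  obtain A where A: "\<And>n x. x \<in> {-1..1} \<Longrightarrow> norm (gegen \<mu> n x) \<le> real (n + 1) ^ A"
    using gegen_growth[OF reg] by blast
  \<comment> \<open>The prefactor grows at most like \<open>N\<^sup>m\<^sup>+\<^sup>1\<close> and \<open>p\<^sub>N(y)\<close> at most like \<open>N\<^sup>A\<close>; a decay of order \<open>m + A + 2\<close>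
      leaves one negative power of \<open>N\<close>.\<close>
  define r where "r = m + A + 2"
  obtain C where C: "C \<ge> 0" "\<And>n. norm (v n) \<le> C / real (n + 1) ^ r"
    using gegen_pairing_decay[OF reg ag, of r] unfolding v_def by blast
  have "(\<lambda>N. \<Sum>n\<le>N. gegen_term \<mu> h n y) \<longlonglongrightarrow> 0"
  proof (rule Lim_null_comparison[OF always_eventually], rule allI)
    fix N
    define R where "R = real (N + 2)"
    have R: "R \<ge> 1" by (simp add: R_def)
    have y': "y \<in> {-1..1}" using y by auto
    have p: "norm (pochhammer c (Suc N) / (2 * fact N)) \<le> R ^ Suc m"
    proof -
      have "pochhammer c (Suc N) / (2 * fact N) = of_nat (Suc N) / 2 * (pochhammer c (Suc N) / fact (Suc N))"
        unfolding fact_Suc by (simp del: of_nat_Suc)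
      hence "norm (pochhammer c (Suc N) / (2 * fact N)) = real (Suc N) / 2 * norm (pochhammer c (Suc N) / fact (Suc N))"
        by (simp only: norm_mult norm_divide norm_of_nat norm_numeral)
      also have "\<dots> \<le> R * R ^ m"
        using m[of "Suc N"] by (intro mult_mono) (auto simp: R_def add_ac)
      finally show ?thesis by simp
    qed
    have uN: "norm (u N) \<le> R ^ A" "norm (u (Suc N)) \<le> R ^ A"
    proof -
      have "real (N + 1) ^ A \<le> R ^ A" by (intro power_mono) (auto simp: R_def)
      thus "norm (u N) \<le> R ^ A" using A[OF y', of N] by (simp add: u_def)
      show "norm (u (Suc N)) \<le> R ^ A" using A[OF y', of "Suc N"] by (simp add: u_def R_def add_ac)
    qed
    have vN: "norm (v (Suc N)) \<le> 2 ^ r * C / R ^ r" "norm (v N) \<le> 2 ^ r * C / R ^ r"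
    proof -
      have "1 * C \<le> 2 ^ r * C" using C(1) by (intro mult_right_mono) auto
      hence "C / R ^ r \<le> 2 ^ r * C / R ^ r" using R by (intro divide_right_mono) auto
      moreover have "norm (v (Suc N)) \<le> C / R ^ r" using C(2)[of "Suc N"] by (simp add: R_def add_ac)
      ultimately show "norm (v (Suc N)) \<le> 2 ^ r * C / R ^ r" by linarith
      have "R ^ r \<le> (2 * real (N + 1)) ^ r" by (intro power_mono) (auto simp: R_def)
      hence "C * R ^ r \<le> C * (2 ^ r * real (N + 1) ^ r)"
        unfolding power_mult_distrib using C(1) by (intro mult_left_mono)
      hence "C / real (N + 1) ^ r \<le> 2 ^ r * C / R ^ r"
        using R by (simp add: field_simps)
      with C(2)[of N] show "norm (v N) \<le> 2 ^ r * C / R ^ r" by linarith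
    qed
    have "norm (u N * v (Suc N) - u (Suc N) * v N) \<le> R ^ A * (2 ^ r * C / R ^ r) + R ^ A * (2 ^ r * C / R ^ r)"
      by (rule order.trans[OF norm_triangle_ineq4], unfold norm_mult, intro add_mono mult_mono uN vN)
         (use R in auto)
    hence "norm (\<Sum>n\<le>N. gegen_term \<mu> h n y) \<le> R ^ Suc m * (R ^ A * (2 ^ r * C / R ^ r) + R ^ A * (2 ^ r * C / R ^ r))"
      unfolding cd norm_mult using R by (intro mult_mono p) auto
    also have "\<dots> = 2 * 2 ^ r * C * (1 / R)"
      using R by (simp add: r_def power_add field_simps power2_eq_square)
    finally show "norm (\<Sum>n\<le>N. gegen_term \<mu> h n y) \<le> 2 * 2 ^ r * C * (1 / real (N + 2))"
      unfolding R_def .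
  next
    have "(\<lambda>N. 1 / real (N + 2)) \<longlonglongrightarrow> 0"
      using LIMSEQ_ignore_initial_segment[OF lim_1_over_n[where 'a = real], of 2] by simp
    hence "(\<lambda>N. 2 * 2 ^ r * C * (1 / real (N + 2))) \<longlonglongrightarrow> 2 * 2 ^ r * C * 0"
      by (intro tendsto_mult tendsto_const)
    thus "(\<lambda>N. 2 * 2 ^ r * C * (1 / real (N + 2))) \<longlonglongrightarrow> 0" by simp
  qed
  thus ?thesis by (simp add: sums_def_le)
qed

section \<open>The Beta integral for complex exponents\<close>

lemma continuous_on_x_ln_x: "continuous_on {0..} (\<lambda>s::real. s * ln s)"
proof (unfold continuous_on, rule ballI)
  fix x :: real assume x: "x \<in> {0..}"
  show "((\<lambda>s. s * ln s) \<longlongrightarrow> x * ln x) (at x within {0..})"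
  proof (cases "x = 0")
    case False
    thus ?thesis using x by (intro tendsto_intros) auto
  next
    case True
    have "((\<lambda>s::real. s * ln s) \<longlongrightarrow> 0) (at 0 within {0..})"
    proof (rule Lim_null_comparison)
      show "\<forall>\<^sub>F s::real in at 0 within {0..}. norm (s * ln s) \<le> 2 * sqrt s"
        unfolding eventually_at
      proof (intro exI[of _ 1] conjI ballI impI)
        fix s :: real assume s: "s \<in> {0..}" "s \<noteq> 0 \<and> dist s 0 < 1"
        hence s': "s > 0" "s < 1" by (auto simp: dist_norm)
        have "- ln s = 2 * ln (inverse (sqrt s))" using s' by (simp add: ln_inverse ln_sqrt)
        also have "\<dots> \<le> 2 * inverse (sqrt s)" using s' ln_bound[of "inverse (sqrt s)"] by simp
        finally have "s * (- ln s) \<le> s * (2 * inverse (sqrt s))" using s' by (intro mult_left_mono) auto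
        also have "s * (2 * inverse (sqrt s)) = 2 * sqrt s" using s' by (simp add: field_simps)
        finally show "norm (s * ln s) \<le> 2 * sqrt s"
          using s' by (simp add: abs_mult)
      qed auto
      have "continuous_on {0..} (\<lambda>s::real. 2 * sqrt s)" by (intro continuous_intros)
      hence "((\<lambda>s::real. 2 * sqrt s) \<longlongrightarrow> 2 * sqrt 0) (at 0 within {0..})"
        unfolding continuous_on by blast
      thus "((\<lambda>s::real. 2 * sqrt s) \<longlongrightarrow> 0) (at 0 within {0..})" by simp
    qed
    thus ?thesis using True by simp
  qed
qed

lemma holomorphic_gegen_weight_integral:
  "(\<lambda>\<mu>. integral {-1..1} (gegen_weight \<mu>)) holomorphic_on {\<mu>. Re \<mu> > 1}"
proof -
  have "(\<lambda>\<mu>. integral (cbox (-1) 1) (gegen_weight \<mu>)) holomorphic_on {\<mu>. Re \<mu> > 1}"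
  proof (rule leibniz_rule_holomorphic)
    fix \<mu> :: complex and t :: real
    show "((\<lambda>\<mu>. gegen_weight \<mu> t) has_field_derivative Ln (of_real (1 - t\<^sup>2)) * gegen_weight \<mu> t) (at \<mu> within {\<mu>. Re \<mu> > 1})"
    proof (cases "complex_of_real (1 - t\<^sup>2) = 0")
      case False
      thus ?thesis unfolding gegen_weight_def
        by (rule has_field_derivative_at_within[OF has_field_derivative_powr_right])
    next
      case True
      thus ?thesis unfolding gegen_weight_def True by simp
    qed
  next
    fix \<mu> :: complex assume "\<mu> \<in> {\<mu>. Re \<mu> > 1}"
    hence "admissible \<mu> (\<lambda>_. 1)" by (auto simp: admissible_def smooth_const)
    from continuous_on_gegen_weight_mult[OF this]
    show "gegen_weight \<mu> integrable_on cbox (-1) 1"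
      by (intro integrable_continuous) simp
  next
    have sq: "t\<^sup>2 \<le> 1" if "t \<in> {-1..1}" for t :: real
      using that by (simp add: abs_square_le_1 abs_le_iff)
    \<comment> \<open>The derivative \<open>s\<^sup>\<mu> ln s\<close> in \<open>\<mu>\<close>, where \<open>s = 1 - t\<^sup>2\<close>, is split as \<open>(s ln s) s\<^sup>\<mu>\<^sup>-\<^sup>1\<close>; both factors are
        continuous up to \<open>s = 0\<close> because \<open>Re \<mu> > 1\<close>.\<close>
    define G where "G = (\<lambda>(\<mu>, t). complex_of_real ((1 - t\<^sup>2) * ln (1 - t\<^sup>2)) * complex_of_real (1 - t\<^sup>2) powr (\<mu> - 1))"
    have cont: "continuous_on ({\<mu>. Re \<mu> > 1} \<times> cbox (-1) 1) G"
      unfolding G_def case_prod_beta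
      by (intro continuous_intros continuous_on_compose2[OF continuous_on_x_ln_x, where f = "\<lambda>z. 1 - (snd z)\<^sup>2"])
         (use sq in auto)
    have *: "G (\<mu>, t) = Ln (of_real (1 - t\<^sup>2)) * gegen_weight \<mu> t" if "t \<in> {-1..1}" for \<mu> t
    proof (cases "1 - t\<^sup>2 = 0")
      case True
      show ?thesis unfolding G_def gegen_weight_def case_prod_conv True by simp
    next
      case False
      define s where "s = 1 - t\<^sup>2"
      have s: "s > 0" using False sq[OF that] by (simp add: s_def)
      have "complex_of_real s * of_real s powr (\<mu> - 1) = of_real s powr \<mu>"
        using s by (simp add: powr_diff powr_to_1)
      thus ?thesis using s unfolding G_def gegen_weight_def case_prod_conv s_def[symmetric]
        by (simp add: Ln_of_real mult_ac)
    qed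
    from cont show "continuous_on ({\<mu>. Re \<mu> > 1} \<times> cbox (-1) 1) (\<lambda>(\<mu>, t). Ln (of_real (1 - t\<^sup>2)) * gegen_weight \<mu> t)"
      by (rule continuous_on_eq) (use * in auto)
  next
    show "convex {\<mu>. Re \<mu> > 1}" by (rule convex_halfspace_Re_gt)
  qed
  thus ?thesis by simp
qed

lemma gegen_weight_integral_real:
  assumes "s > (0 :: real)"
  shows "integral {-1..1} (gegen_weight (of_real s)) = of_real (2 * 4 powr s * Beta (s + 1) (s + 1))"
proof -
  have "((\<lambda>t. t powr (s + 1 - 1) * (1 - t) powr (s + 1 - 1)) has_integral Beta (s + 1) (s + 1)) (cbox 0 1)"
    using assms has_integral_Beta_real[of "s + 1" "s + 1"] by simp
  from has_integral_affinity'[OF this, of "1 / 2" "1 / 2"]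
  have "((\<lambda>x. (x / 2 + 1 / 2) powr s * (1 - (x / 2 + 1 / 2)) powr s) has_integral 2 * Beta (s + 1) (s + 1)) {-1..1}"
    by simp
  from has_integral_mult_right[OF this, of "4 powr s"]
  have "((\<lambda>x. 4 powr s * ((x / 2 + 1 / 2) powr s * (1 - (x / 2 + 1 / 2)) powr s)) has_integral 2 * 4 powr s * Beta (s + 1) (s + 1)) {-1..1}"
    by (simp add: mult_ac)
  hence "((\<lambda>x. (1 - x\<^sup>2) powr s) has_integral 2 * 4 powr s * Beta (s + 1) (s + 1)) {-1..1}"
  proof (rule has_integral_eq[rotated])
    fix x :: real assume x: "x \<in> {-1..1}"
    have "1 - x\<^sup>2 = 4 * ((x / 2 + 1 / 2) * (1 - (x / 2 + 1 / 2)))"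
      by (simp add: power2_eq_square field_simps)
    thus "4 powr s * ((x / 2 + 1 / 2) powr s * (1 - (x / 2 + 1 / 2)) powr s) = (1 - x\<^sup>2) powr s"
      using x by (simp add: powr_mult)
  qed
  from has_integral_of_real[OF this]
  have "((\<lambda>x. complex_of_real ((1 - x\<^sup>2) powr s)) has_integral of_real (2 * 4 powr s * Beta (s + 1) (s + 1))) {-1..1}" .
  hence "(gegen_weight (of_real s) has_integral of_real (2 * 4 powr s * Beta (s + 1) (s + 1))) {-1..1}"
  proof (rule has_integral_eq[rotated])
    fix x :: real assume x: "x \<in> {-1..1}"
    hence "1 - x\<^sup>2 \<ge> 0" by (simp add: abs_square_le_1 abs_le_iff)
    thus "complex_of_real ((1 - x\<^sup>2) powr s) = gegen_weight (of_real s) x"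
      unfolding gegen_weight_def by (simp only: powr_of_real)
  qed
  thus ?thesis by (rule integral_unique)
qed

text \<open>
  The Beta integral \<open>\<integral> (1 - x\<^sup>2)\<^sup>\<mu> dx\<close> for complex exponents, continued analytically from real ones.
\<close>
lemma gegen_weight_integral:
  assumes "Re \<mu> > 1"
  shows "integral {-1..1} (gegen_weight \<mu>) * rGamma (\<mu> + 1) ^ 2 * Gamma (2 * \<mu> + 2) = 2 * 2 powr (2 * \<mu>)"
proof -
  let ?F = "\<lambda>\<mu>. integral {-1..1} (gegen_weight \<mu>) * rGamma (\<mu> + 1) ^ 2 * Gamma (2 * \<mu> + 2) - 2 * 2 powr (2 * \<mu>)"
  let ?S = "{\<mu>. Re \<mu> > 1}"
  have reg: "2 * \<mu> + 2 \<notin> \<int>\<^sub>\<le>\<^sub>0" if "\<mu> \<in> ?S" for \<mu>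
    using that by (auto elim!: nonpos_Ints_cases' simp: complex_eq_iff)
  have "?F \<mu> = 0"
  proof (rule analytic_continuation[where f = ?F and w = \<mu> and S = ?S and U = "of_real ` {2<..}" and \<xi> = 3])
    show "?F holomorphic_on ?S"
      by (intro holomorphic_intros holomorphic_gegen_weight_integral reg)
    show "open ?S" by (rule open_halfspace_Re_gt)
    show "connected ?S" by (intro convex_connected convex_halfspace_Re_gt)
    show "complex_of_real ` {2<..} \<subseteq> ?S" by auto
    show "3 \<in> ?S" by simp
    show "\<mu> \<in> ?S" using assms by simp
    show "(3::complex) islimpt of_real ` {2<..}"
    proof -
      have "(\<lambda>n. complex_of_real (3 + 1 / real (Suc n))) \<longlonglongrightarrow> of_real (3 + 0)"
        by (intro tendsto_of_real tendsto_add tendsto_const LIMSEQ_Suc[OF lim_1_over_n])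
      moreover have "complex_of_real (3 + 1 / real (Suc n)) \<in> of_real ` {2<..} - {3}" for n
      proof -
        define t where "t = 3 + 1 / real (Suc n)"
        have "t > 3" by (simp add: t_def add_pos_nonneg)
        moreover from this have "complex_of_real t \<noteq> 3" using of_real_eq_iff[of t 3] by simp
        ultimately show ?thesis unfolding t_def[symmetric] by auto
      qed
      ultimately show ?thesis unfolding islimpt_sequential
        by (intro exI[of _ "\<lambda>n. complex_of_real (3 + 1 / real (Suc n))"]) simp
    qed
    fix z assume "z \<in> complex_of_real ` {2<..}"
    then obtain s where s: "z = of_real s" "s > 2" by auto
    have nz: "Gamma (s + 1) \<noteq> 0" "Gamma (2 * s + 2) \<noteq> 0"
      using s by (auto simp: Gamma_eq_zero_iff elim!: nonpos_Ints_cases')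
    have B: "Beta (s + 1) (s + 1) * rGamma (s + 1) ^ 2 * Gamma (2 * s + 2) = 1"
      using nz by (simp add: Beta_def rGamma_inverse_Gamma power2_eq_square field_simps)
    have rG: "rGamma (z + 1) = of_real (rGamma (s + 1))" "Gamma (2 * z + 2) = of_real (Gamma (2 * s + 2))"
      by (simp_all add: s(1) rGamma_complex_of_real[symmetric] Gamma_complex_of_real[symmetric])
    have "2 powr (2 * z) = complex_of_real (4 powr s)"
    proof -
      have "complex_of_real (2 powr (2 * s)) = of_real 2 powr of_real (2 * s)" by (rule powr_of_real[symmetric]) simp
      moreover have "2 powr (2 * s) = (4 :: real) powr s" by (simp flip: powr_powr)
      ultimately show ?thesis by (simp add: s(1))
    qed
    moreover have "integral {-1..1} (gegen_weight z) * rGamma (z + 1) ^ 2 * Gamma (2 * z + 2) =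
      of_real (2 * 4 powr s * (Beta (s + 1) (s + 1) * rGamma (s + 1) ^ 2 * Gamma (2 * s + 2)))"
      unfolding rG using gegen_weight_integral_real[of s] s by simp
    ultimately show "?F z = 0" unfolding B by simp
  qed
  thus ?thesis by simp
qed

section \<open>The Gegenbauer expansion for all complex orders\<close>

text \<open>
  The part of the normalisation that is independent of \<open>n\<close>. The squared factor stems from the two
  occurrences of the Ferrers function.
\<close>
definition gegen_total :: "complex \<Rightarrow> complex" where
  "gegen_total \<mu> = Gamma (2 * \<mu> + 1) * (rGamma (\<mu> + 1) * 2 powr (- \<mu>))\<^sup>2"

lemma gegen_total_mult_integral:
  assumes "Re \<mu> > 1"
  shows "gegen_total \<mu> * (gegen_norm \<mu> 0 * integral {-1..1} (gegen_weight \<mu>)) = 1"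
proof -
  have nz: "2 * \<mu> + 1 \<notin> \<int>\<^sub>\<le>\<^sub>0"
    using assms by (auto elim!: nonpos_Ints_cases' simp: complex_eq_iff)
  have "Gamma (2 * \<mu> + 2) = (2 * \<mu> + 1) * Gamma (2 * \<mu> + 1)"
    using Gamma_plus1[OF nz] by (simp add: add.assoc)
  hence "gegen_total \<mu> * (gegen_norm \<mu> 0 * integral {-1..1} (gegen_weight \<mu>)) =
     (integral {-1..1} (gegen_weight \<mu>) * rGamma (\<mu> + 1) ^ 2 * Gamma (2 * \<mu> + 2)) * (2 powr (- \<mu>))\<^sup>2 / 2"
    by (simp add: gegen_total_def gegen_norm_def power_mult_distrib)
  also have "\<dots> = 2 powr (2 * \<mu>) * (2 powr (- \<mu>))\<^sup>2"
    unfolding gegen_weight_integral[OF assms] by simp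
  also have "\<dots> = 2 powr (2 * \<mu> + (- \<mu>) + (- \<mu>))"
    by (simp only: powr_add power2_eq_square mult.assoc)
  also have "\<dots> = 1" by simp
  finally show ?thesis .
qed

lemma gegen_total_plus1:
  assumes reg: "2 * \<mu> + 1 \<notin> \<int>\<^sub>\<le>\<^sub>0"
  shows "gegen_total (\<mu> + 1) * (4 * (\<mu> + 1)\<^sup>2) = gegen_total \<mu> * ((2 * \<mu> + 1) * (2 * \<mu> + 2))"
proof -
  have "2 * \<mu> + 2 \<notin> \<int>\<^sub>\<le>\<^sub>0"
  proof
    assume "2 * \<mu> + 2 \<in> \<int>\<^sub>\<le>\<^sub>0"
    then obtain k where "2 * \<mu> + 2 = - of_nat k" by (auto elim!: nonpos_Ints_cases')
    hence "2 * \<mu> + 1 + of_nat (Suc k) = 0" by (simp add: algebra_simps)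
    thus False using gegen_order_regular(2)[OF reg] by blast
  qed
  hence "Gamma (2 * \<mu> + 2 + 1) = (2 * \<mu> + 2) * Gamma (2 * \<mu> + 2)" by (rule Gamma_plus1)
  moreover have "Gamma (2 * \<mu> + 1 + 1) = (2 * \<mu> + 1) * Gamma (2 * \<mu> + 1)" by (rule Gamma_plus1[OF reg])
  ultimately have G: "Gamma (2 * (\<mu> + 1) + 1) = (2 * \<mu> + 2) * (2 * \<mu> + 1) * Gamma (2 * \<mu> + 1)"
    by (simp add: add.assoc)
  have R: "(\<mu> + 1) * rGamma (\<mu> + 1 + 1) = rGamma (\<mu> + 1)" by (rule rGamma_plus1)
  have "2 powr (- (\<mu> + 1)) * 2 = (2 powr (- (\<mu> + 1) + 1) :: complex)"
    by (simp only: powr_add powr_to_1)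
  hence P: "2 powr (- (\<mu> + 1)) * 2 = (2 powr (- \<mu>) :: complex)" by simp
  have "gegen_total (\<mu> + 1) * (4 * (\<mu> + 1)\<^sup>2) =
    Gamma (2 * (\<mu> + 1) + 1) * (((\<mu> + 1) * rGamma (\<mu> + 1 + 1)) * (2 powr (- (\<mu> + 1)) * 2))\<^sup>2"
    by (simp only: gegen_total_def power_mult_distrib) (simp add: mult_ac)
  also have "\<dots> = gegen_total \<mu> * ((2 * \<mu> + 1) * (2 * \<mu> + 2))"
    unfolding G R P gegen_total_def by (simp only: mult_ac)
  finally show ?thesis .
qed

text \<open>
  If \<open>Re \<mu> > 1\<close>, constants are admissible, and only their zeroth coefficient is non-zero. Subtracting
  the constant \<open>h(x)\<close> leads back to a function that vanishes at \<open>x\<close>.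
\<close>
lemma gegen_expansion_base:
  assumes reg: "2 * \<mu> + 1 \<notin> \<int>\<^sub>\<le>\<^sub>0" and re: "Re \<mu> > 1" and h: "smooth h" and x: "x \<in> {-1<..<1}"
  shows "(\<lambda>n. gegen_total \<mu> * gegen_term \<mu> h n x) sums h x"
proof -
  have ah: "admissible \<mu> h" and a1: "admissible \<mu> (\<lambda>_. c)" for c
    using h re by (auto simp: admissible_def smooth_const)
  have const: "gegen_pairing \<mu> n (\<lambda>_. h x) = (if n = 0 then h x * integral {-1..1} (gegen_weight \<mu>) else 0)" for n
  proof (cases n)
    case 0
    show ?thesis using gegen_pairing_cmult[of \<mu> 0 "h x" "\<lambda>_. 1"] by (simp add: 0 gegen_pairing_def)
  next
    case (Suc k)
    \<comment> \<open>The Gegenbauer operator annihilates constants, while \<open>n (n + 2\<mu> + 1) \<noteq> 0\<close>.\<close>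
    have "vderiv (\<lambda>_. c) = (\<lambda>_. 0)" for c by (simp add: vderiv_def fun_eq_iff)
    hence "gegen_op \<mu> (\<lambda>_. h x) = (\<lambda>_. 0)" by (simp add: gegen_op_def[abs_def])
    hence "gegen_pairing \<mu> n (gegen_op \<mu> (\<lambda>_. h x)) = 0" by (simp add: gegen_pairing_def)
    moreover have "of_nat n + 2 * \<mu> + 1 = 2 * \<mu> + 1 + of_nat n" by simp
    hence "of_nat n + 2 * \<mu> + 1 \<noteq> 0" using gegen_order_regular(2)[OF reg, of n] by metis
    hence "of_nat n * (of_nat n + 2 * \<mu> + 1) \<noteq> 0"
      unfolding Suc by (metis mult_eq_0_iff of_nat_neq_0)
    ultimately show ?thesis using gegen_pairing_op[OF reg a1, of n] Suc by simp
  qed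
  have "(\<lambda>n. gegen_term \<mu> (\<lambda>t. h t - h x) n x) sums 0"
    by (rule sums_gegen_term_at_zero[OF reg _ x]) (auto intro: admissible_diff ah a1)
  moreover have "(\<lambda>n. gegen_term \<mu> (\<lambda>_. h x) n x) sums (gegen_norm \<mu> 0 * (h x * integral {-1..1} (gegen_weight \<mu>)))"
  proof -
    have "(\<lambda>n. gegen_term \<mu> (\<lambda>_. h x) n x) =
        (\<lambda>n. if n = 0 then gegen_norm \<mu> 0 * (h x * integral {-1..1} (gegen_weight \<mu>)) else 0)"
      by (auto simp: gegen_term_def const)
    thus ?thesis
      using sums_single[of 0 "\<lambda>_. gegen_norm \<mu> 0 * (h x * integral {-1..1} (gegen_weight \<mu>))"] by simp
  qed
  ultimately have "(\<lambda>n. gegen_term \<mu> (\<lambda>t. h t - h x) n x + gegen_term \<mu> (\<lambda>_. h x) n x)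
      sums (0 + gegen_norm \<mu> 0 * (h x * integral {-1..1} (gegen_weight \<mu>)))" by (rule sums_add)
  also have "(\<lambda>n. gegen_term \<mu> (\<lambda>t. h t - h x) n x + gegen_term \<mu> (\<lambda>_. h x) n x) = (\<lambda>n. gegen_term \<mu> h n x)"
    unfolding gegen_term_def gegen_pairing_diff[OF ah a1] by (simp add: algebra_simps)
  finally have "(\<lambda>n. gegen_total \<mu> * gegen_term \<mu> h n x) sums
      (gegen_total \<mu> * (0 + gegen_norm \<mu> 0 * (h x * integral {-1..1} (gegen_weight \<mu>))))"
    by (rule sums_mult)
  also have "gegen_total \<mu> * (0 + gegen_norm \<mu> 0 * (h x * integral {-1..1} (gegen_weight \<mu>))) = h x"
  proof -
    have "gegen_total \<mu> * (0 + gegen_norm \<mu> 0 * (h x * integral {-1..1} (gegen_weight \<mu>))) =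
        h x * (gegen_total \<mu> * (gegen_norm \<mu> 0 * integral {-1..1} (gegen_weight \<mu>)))"
      by (simp only: add_0 mult_ac)
    thus ?thesis unfolding gegen_total_mult_integral[OF re] by simp
  qed
  finally show ?thesis .
qed

lemma gegen_term_deriv_shift:
  assumes reg: "2 * \<mu> + 1 \<notin> \<int>\<^sub>\<le>\<^sub>0" and h: "admissible \<mu> h"
  shows "gegen_total \<mu> * (gegen_norm \<mu> (Suc n) * (gegen_deriv \<mu> (Suc n) x * gegen_pairing \<mu> (Suc n) h)) =
         gegen_total (\<mu> + 1) * gegen_term (\<mu> + 1) (vderiv h) n x"
proof -
  define c m N where "c = 2 * \<mu> + 1" and "m = \<mu> + 1" and "N = (of_nat (Suc n) :: complex)"
  define g I P T where "g = gegen (\<mu> + 1) n x" and "I = gegen_pairing \<mu> (Suc n) h"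
    and "P = pochhammer (c + 2) n / fact n" and "T = gegen_total (\<mu> + 1)"
  have nz: "m \<noteq> 0" "N \<noteq> 0" using gegen_order_regular(4)[OF reg] by (simp_all add: m_def N_def del: of_nat_Suc)
  have "pochhammer c (Suc (Suc n)) = c * ((c + 1) * pochhammer (c + 2) n)"
    by (simp only: pochhammer_rec[of c "Suc n"] pochhammer_rec[of "c + 1" n]) (simp add: add.assoc)
  moreover have "pochhammer c (Suc (Suc n)) = pochhammer c (Suc n) * (c + N)"
    by (simp only: pochhammer_Suc[of c "Suc n"] N_def)
  ultimately have AB: "pochhammer c (Suc n) * (c + N) = c * ((c + 1) * pochhammer (c + 2) n)" by simp
  have cancel: "A / (N * F) * (N * (N + c)) = A * (c + N) / F" for A F
    using nz by (simp add: add.commute)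
  have p: "pochhammer c (Suc n) / fact (Suc n) * (N * (N + c)) = c * (c + 1) * P"
    unfolding P_def fact_Suc[of n] N_def[symmetric] cancel AB by simp
  have T: "T * (4 * m\<^sup>2) = gegen_total \<mu> * (c * (c + 1))"
    using gegen_total_plus1[OF reg] by (simp add: T_def m_def c_def add.assoc)
  have "gegen_deriv \<mu> (Suc n) x = N * (N + c) / (2 * m) * g"
    unfolding gegen_deriv_eq[OF reg] by (simp add: N_def c_def m_def g_def add.assoc)
  hence "gegen_total \<mu> * (gegen_norm \<mu> (Suc n) * (gegen_deriv \<mu> (Suc n) x * I)) =
     gegen_total \<mu> * (N + c / 2) * (pochhammer c (Suc n) / fact (Suc n) * (N * (N + c))) * (g * I) / (2 * m)"
    by (simp only: gegen_norm_def c_def[symmetric] N_def[symmetric]) (simp add: mult_ac)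
  also have "\<dots> = (gegen_total \<mu> * (c * (c + 1))) * (N + c / 2) * P * (g * I) / (2 * m)"
    unfolding p by (simp add: mult_ac)
  also have "\<dots> = T * ((N + c / 2) * P * (g * (2 * m * I)))"
    unfolding T[symmetric] using nz by (simp add: power2_eq_square field_simps)
  also have "(N + c / 2) * P = gegen_norm (\<mu> + 1) n"
  proof -
    have "N + c / 2 = of_nat n + (2 * (\<mu> + 1) + 1) / 2" by (simp add: N_def c_def field_simps)
    moreover have "c + 2 = 2 * (\<mu> + 1) + 1" by (simp add: c_def)
    ultimately show ?thesis by (simp add: gegen_norm_def P_def)
  qed
  also have "2 * m * I = gegen_pairing (\<mu> + 1) n (vderiv h)"
    unfolding gegen_pairing_shift[OF reg h] I_def m_def ..
  finally show ?thesis by (simp add: gegen_term_def I_def T_def g_def)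
qed

text \<open>
  The expansion of \<open>h'\<close> for \<open>\<mu> + 1\<close> is the termwise derivative of the expansion of \<open>h\<close> for \<open>\<mu>\<close>. So the
  latter has the sum \<open>h + const\<close>, and the constant is zero because \<open>h\<close> has a zero in \<open>(-1, 1)\<close>,
  where the series is known to sum to zero.
\<close>
lemma gegen_expansion_shift:
  assumes reg: "2 * \<mu> + 1 \<notin> \<int>\<^sub>\<le>\<^sub>0" and h: "smooth h" "vanishes_near_ends h" and x: "x \<in> {-1<..<1}"
    and up: "\<And>x. x \<in> {-1<..<1} \<Longrightarrow> (\<lambda>n. gegen_total (\<mu> + 1) * gegen_term (\<mu> + 1) (vderiv h) n x) sums vderiv h x"
  shows "(\<lambda>n. gegen_total \<mu> * gegen_term \<mu> h n x) sums h x"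
proof -
  have ah: "admissible \<mu> h" using h by (simp add: admissible_def)
  define T where "T n x = gegen_total \<mu> * gegen_term \<mu> h n x" for n x
  define T' where "T' n x = gegen_total \<mu> * (gegen_norm \<mu> n * (gegen_deriv \<mu> n x * gegen_pairing \<mu> n h))" for n x
  define S :: "real set" where "S = {-1<..<1}"
  have der: "(T n has_vector_derivative T' n x) (at x within S)" for n x
    unfolding T_def[abs_def] gegen_term_def T'_def
    by (rule has_vector_derivative_mult_right, rule has_vector_derivative_mult_right,
        rule has_vector_derivative_mult_left, rule has_vector_derivative_gegen)
  have T'0: "T' 0 x = 0" for x by (simp add: T'_def gegen_deriv_def gegen_poly_def pderiv_monom)
  have T'Suc: "T' (Suc n) x = gegen_total (\<mu> + 1) * gegen_term (\<mu> + 1) (vderiv h) n x" for n x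
    unfolding T'_def by (rule gegen_term_deriv_shift[OF reg ah])
  obtain C where C: "\<And>n x. x \<in> {-1..1} \<Longrightarrow> norm (gegen_term (\<mu> + 1) (vderiv h) n x) \<le> C / real (n + 1) ^ 2"
    using gegen_term_bound[OF gegen_order_regular(5)[OF reg] admissible_plus1[OF admissible_vderiv[OF ah]]] by blast
  have T'_sums: "(\<lambda>n. T' n x) sums vderiv h x" if "x \<in> S" for x
    by (rule sums_Suc_imp) (use up[of x] that in \<open>simp_all add: T'0 T'Suc S_def\<close>)
  have unif: "uniform_limit S (\<lambda>N x. \<Sum>n<N. T' n x) (\<lambda>x. \<Sum>n. T' n x) sequentially"
  proof (rule Weierstrass_m_test)
    fix n x assume "x \<in> S"
    hence x: "x \<in> {-1..1}" by (auto simp: S_def)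
    show "norm (T' n x) \<le> norm (gegen_total (\<mu> + 1)) * C * inverse (real n ^ 2)"
    proof (cases n)
      case (Suc k)
      have "norm (T' n x) \<le> norm (gegen_total (\<mu> + 1)) * (C / real (k + 1) ^ 2)"
        unfolding Suc T'Suc norm_mult by (intro mult_left_mono C x) auto
      thus ?thesis by (simp add: Suc field_simps)
    qed (simp add: T'0)
  next
    show "summable (\<lambda>n. norm (gegen_total (\<mu> + 1)) * C * inverse (real n ^ 2))"
      by (intro summable_mult inverse_power_summable) simp
  qed
  obtain a where a: "a < 1" "\<And>x. a \<le> \<bar>x\<bar> \<Longrightarrow> h x = 0"
    using h(2) unfolding vanishes_near_ends_def by blast
  \<comment> \<open>A zero of \<open>h\<close> inside \<open>(-1, 1)\<close>, outside the support.\<close>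
  define y where "y = max a 0"
  have y: "y \<in> S" "h y = 0" using a by (auto simp: y_def S_def)
  have "(\<lambda>n. gegen_total \<mu> * gegen_term \<mu> h n y) sums (gegen_total \<mu> * 0)"
    using y by (intro sums_mult sums_gegen_term_at_zero[OF reg ah]) (auto simp: S_def)
  hence Ty: "(\<lambda>n. T n y) sums 0" by (simp add: T_def)
  have "\<exists>g. \<forall>x\<in>S. (\<lambda>n. T n x) sums g x \<and> (g has_derivative (\<lambda>t. t *\<^sub>R vderiv h x)) (at x within S)"
  proof (rule has_derivative_series[where f' = "\<lambda>n x t. t *\<^sub>R T' n x"])
    show "convex S" by (simp add: S_def)
    show "(T n has_derivative (\<lambda>t. t *\<^sub>R T' n x)) (at x within S)" for n x
      using der[of n x] by (simp add: has_vector_derivative_def)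
    show "y \<in> S" by fact
    show "(\<lambda>n. T n y) sums 0" by fact
    fix e :: real assume "e > 0"
    from uniform_limitD[OF unif this]
    show "\<forall>\<^sub>F N in sequentially. \<forall>x\<in>S. \<forall>t. norm ((\<Sum>n<N. t *\<^sub>R T' n x) - t *\<^sub>R vderiv h x) \<le> e * norm t"
    proof eventually_elim
      case (elim N)
      show ?case
      proof (intro ballI allI)
        fix x t assume "x \<in> S"
        hence "norm ((\<Sum>n<N. T' n x) - vderiv h x) \<le> e" 
          using elim sums_unique[OF T'_sums] by (auto simp: dist_norm intro: less_imp_le)
        hence "\<bar>t\<bar> * norm ((\<Sum>n<N. T' n x) - vderiv h x) \<le> \<bar>t\<bar> * e" by (intro mult_left_mono) auto
        thus "norm ((\<Sum>n<N. t *\<^sub>R T' n x) - t *\<^sub>R vderiv h x) \<le> e * norm t"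
          by (simp add: scaleR_right_diff_distrib[symmetric] scaleR_sum_right[symmetric] mult.commute)
      qed
    qed
  qed
  then obtain g where g: "\<And>x. x \<in> S \<Longrightarrow> (\<lambda>n. T n x) sums g x"
     "\<And>x. x \<in> S \<Longrightarrow> (g has_derivative (\<lambda>t. t *\<^sub>R vderiv h x)) (at x within S)" by blast
  have "\<exists>c. \<forall>x\<in>S. g x - h x = c"
  proof (rule has_derivative_zero_constant)
    show "convex S" by (simp add: S_def)
    fix x assume x: "x \<in> S"
    have "(h has_derivative (\<lambda>t. t *\<^sub>R vderiv h x)) (at x within S)"
      using has_vector_derivative_at_within[OF smooth_vderiv(1)[OF h(1)]] by (simp add: has_vector_derivative_def)
    from has_derivative_diff[OF g(2)[OF x] this]
    show "((\<lambda>x. g x - h x) has_derivative (\<lambda>t. 0)) (at x within S)" by simp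
  qed
  then obtain c where c: "\<And>x. x \<in> S \<Longrightarrow> g x - h x = c" by blast
  have "g y = 0" using sums_unique2[OF g(1)[OF y(1)] Ty] .
  hence "c = 0" using c[OF y(1)] y(2) by simp
  hence "g x = h x" using c[of x] x by (simp add: S_def)
  thus ?thesis using g(1)[of x] x by (simp add: S_def T_def)
qed

lemma gegen_expansion:
  assumes "2 * \<mu> + 1 \<notin> \<int>\<^sub>\<le>\<^sub>0" "smooth h" "vanishes_near_ends h" "x \<in> {-1<..<1}"
  shows "(\<lambda>n. gegen_total \<mu> * gegen_term \<mu> h n x) sums h x"
proof -
  \<comment> \<open>The induction is on the number of steps \<open>\<mu> \<mapsto> \<mu> + 1\<close> that lead into the half plane \<open>Re \<mu> > 1\<close>.\<close>
  obtain k :: nat where "1 - Re \<mu> < real k" using reals_Archimedean2 by blast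
  hence "Re \<mu> + real k > 1" by simp
  thus ?thesis using assms
  proof (induction k arbitrary: \<mu> h x)
    case 0
    thus ?case by (intro gegen_expansion_base) auto
  next
    case (Suc k)
    show ?case
    proof (rule gegen_expansion_shift[OF Suc.prems(2-5)])
      fix t :: real assume t: "t \<in> {-1<..<1}"
      show "(\<lambda>n. gegen_total (\<mu> + 1) * gegen_term (\<mu> + 1) (vderiv h) n t) sums vderiv h t"
        by (rule Suc.IH[OF _ gegen_order_regular(5)[OF Suc.prems(2)] smooth_vderiv(2)[OF Suc.prems(3)]
              vanishes_near_ends_vderiv[OF Suc.prems(4)] t])
           (use Suc.prems(1) in simp)
    qed
  qed
qed

section \<open>The closure relation for Ferrers functions\<close>

theorem theorem3p23:
  fixes x' :: real and \<mu> :: complex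
  assumes "x' \<in> {-1<..<1}"
    and "2 * \<mu> + 1 \<notin> \<int>\<^sub>\<le>\<^sub>0"
  shows "\<forall>f \<in> test_functions {-1<..<1}.
    (\<lambda>n. (\<mu> + of_nat n + 1 / 2) * Gamma (2 * \<mu> + of_nat n + 1) / fact n *
          Ferrers_P (of_nat n + \<mu>) (- \<mu>) x' *
          integral {-1<..<1} (\<lambda>x. f x * Ferrers_P (of_nat n + \<mu>) (- \<mu>) x))
    sums f x'"
proof
  fix f assume f: "f \<in> test_functions {-1<..<1}"
  define r where "r = rGamma (\<mu> + 1) * 2 powr (- \<mu>)"
  \<comment> \<open>One factor \<open>(1 - x\<^sup>2)\<^sup>\<mu>\<^sup>/\<^sup>2\<close> of the Ferrers function under the integral is used to complete the
      weight \<open>(1 - x\<^sup>2)\<^sup>\<mu>\<close>, at the price of expanding \<open>h\<close> instead of \<open>f\<close>.\<close>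
  define h where "h x = gegen_weight (- \<mu> / 2) x * f x" for x
  have h: "smooth h" "vanishes_near_ends h"
    unfolding h_def
    using test_functions_vanish[OF f] by (auto intro: smooth_gegen_weight_mult vanishes_near_ends_mult)
  have P: "Ferrers_P (of_nat n + \<mu>) (- \<mu>) x = r * (gegen_weight (\<mu> / 2) x * gegen \<mu> n x)" if "x \<in> {-1<..<1}" for n x
    using Ferrers_P_eq_gegen[OF assms(2) that] by (simp add: r_def gegen_weight_def mult_ac)
  have fh: "gegen_weight (\<mu> / 2) x * h x = f x" if "x \<in> {-1<..<1}" for x
  proof -
    have "complex_of_real (1 - x\<^sup>2) \<noteq> 0" using one_minus_sq_pos[OF that] by (metis of_real_eq_0_iff less_irrefl)
    hence "gegen_weight (\<mu> / 2) x * gegen_weight (- \<mu> / 2) x = 1"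
      unfolding gegen_weight_def powr_add[symmetric] by simp
    thus ?thesis by (simp add: h_def mult.assoc[symmetric])
  qed
  have int: "integral {-1<..<1} (\<lambda>x. f x * Ferrers_P (of_nat n + \<mu>) (- \<mu>) x) = r * gegen_pairing \<mu> n h" for n
  proof -
    have "integral {-1<..<1} (\<lambda>x. f x * Ferrers_P (of_nat n + \<mu>) (- \<mu>) x) =
        integral {-1<..<1} (\<lambda>x. r * (gegen_weight \<mu> x * (h x * gegen \<mu> n x)))"
    proof (rule integral_cong)
      fix x :: real assume x: "x \<in> {-1<..<1}"
      have "gegen_weight \<mu> x = gegen_weight (\<mu> / 2) x * gegen_weight (\<mu> / 2) x"
        unfolding gegen_weight_def powr_add[symmetric] by simp
      thus "f x * Ferrers_P (of_nat n + \<mu>) (- \<mu>) x = r * (gegen_weight \<mu> x * (h x * gegen \<mu> n x))"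
        unfolding P[OF x] fh[OF x, symmetric] by (simp add: mult_ac)
    qed
    thus ?thesis
      unfolding gegen_pairing_def integral_open_interval_real[symmetric] by simp
  qed
  have "(\<lambda>n. gegen_weight (\<mu> / 2) x' * (gegen_total \<mu> * gegen_term \<mu> h n x')) sums (gegen_weight (\<mu> / 2) x' * h x')"
    by (intro sums_mult gegen_expansion assms h)
  also have "gegen_weight (\<mu> / 2) x' * h x' = f x'" by (rule fh[OF assms(1)])
  also have "(\<lambda>n. gegen_weight (\<mu> / 2) x' * (gegen_total \<mu> * gegen_term \<mu> h n x')) =
    (\<lambda>n. (\<mu> + of_nat n + 1 / 2) * Gamma (2 * \<mu> + of_nat n + 1) / fact n *
          Ferrers_P (of_nat n + \<mu>) (- \<mu>) x' *
          integral {-1<..<1} (\<lambda>x. f x * Ferrers_P (of_nat n + \<mu>) (- \<mu>) x))"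
  proof
    fix n
    have nzG: "Gamma (2 * \<mu> + 1) \<noteq> 0" using assms(2) by (simp add: Gamma_eq_zero_iff)
    have G: "Gamma (2 * \<mu> + of_nat n + 1) = Gamma (2 * \<mu> + 1) * pochhammer (2 * \<mu> + 1) n"
      using pochhammer_Gamma[OF assms(2), of n] nzG by (simp add: field_simps)
    have N: "\<mu> + of_nat n + 1 / 2 = of_nat n + (2 * \<mu> + 1) / 2" by (simp add: field_simps)
    show "gegen_weight (\<mu> / 2) x' * (gegen_total \<mu> * gegen_term \<mu> h n x') =
       (\<mu> + of_nat n + 1 / 2) * Gamma (2 * \<mu> + of_nat n + 1) / fact n *
          Ferrers_P (of_nat n + \<mu>) (- \<mu>) x' *
          integral {-1<..<1} (\<lambda>x. f x * Ferrers_P (of_nat n + \<mu>) (- \<mu>) x)"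
      unfolding int P[OF assms(1)] G N gegen_total_def gegen_term_def gegen_norm_def r_def[symmetric]
      by (simp only: times_divide_eq_left times_divide_eq_right power2_eq_square mult_ac)
  qed
  finally show "(\<lambda>n. (\<mu> + of_nat n + 1 / 2) * Gamma (2 * \<mu> + of_nat n + 1) / fact n *
          Ferrers_P (of_nat n + \<mu>) (- \<mu>) x' *
          integral {-1<..<1} (\<lambda>x. f x * Ferrers_P (of_nat n + \<mu>) (- \<mu>) x)) sums f x'" .
qed

end
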